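(* Suppose that $f$ is convex and $L_f$-smooth, the condition number of $A$ is $\kappa_A$ and $\|x_0-x^\star\|\le D$, where $x^\star$ is a minimizer of $F$. For any given $0<\rho<+\infty$ and $\epsilon>0$, the Inexact PPA algorithm (described in the context) can be applied to the problem $$\min_x\ f(x)+h(Ax-b)+\frac{\epsilon}{2D^2}\|x-x_0\|^2$$ and output an approximate solution $\hat x$ satisfying $\mathrm{SubOpt}_{\mathsf C}(\hat x)\le\epsilon$, such that the total number of gradient evaluations is bounded by $$\tilde O\left(\frac{\kappa_A\sqrt{L_f}D}{\sqrt\epsilon}\right),$$ where $\tilde O$ also hides the logarithmic dependence on $\rho$.
   Context: Problem: $\min_{x\in\mathbb{R}^n}F(x):=f(x)+h(Ax-b)$, where $f:\mathbb{R}^n\to\mathbb{R}$ is differentiable with $L_f$-Lipschitz gradient, $h:\mathbb{R}^m\to\mathbb{R}\cup\{+\infty\}$ is proper closed convex with computable proximal operator, $A\in\mathbb{R}^{m\times n}$ has full row rank, $L_A=\|A\|$, $\mu_A$ is its minimal singular value, $\kappa_A=L_A/\mu_A$. Here $h^\star$ is the convex conjugate and $\mathrm{prox}_g(x)=\arg\min_u\{g(u)+\frac12\|x-u\|^2\}$. Suboptimality measure: $\mathrm{SubOpt}_{\mathsf C}(x):=f(x)+h_\rho(Ax-b)-\min_{x'}\{f(x')+h(Ax'-b)\}$, where $h_\rho(z):=\sup_{\|y\|_2\le\rho}\{z^{\mathrm T}y-h^\star(y)\}$. Inexact PPA algorithm for $\min_x\phi(x)+h(Ax-b)$ with $\phi$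 $L$-smooth and $\mu$-strongly convex (here $\phi=f+\frac{\epsilon}{2D^2}\|\cdot-x_0\|^2$): input $x_0,\lambda_0$, $\ell\ge\mu_\Phi:=\mu_A^2/L$ (suitably chosen), radius $R>0$; let $r=\frac{\mu_\Phi}{12\ell}$, $\delta_k=(1-r)^{k/2}R$. For $k=1,\dots,T$: with $\Psi_k(x)=\phi(x)+\max_\lambda\{\lambda^{\mathrm T}(Ax-b)-h^\star(\lambda)-\frac\ell2\|\lambda-\lambda_{k-1}\|^2\}$, which is $(L+L_A^2/\ell)$-smooth and $\mu$-strongly convex, let $x_k=\mathrm{AGD}(\Psi_k,x_{k-1},\delta_k)$ and $\lambda_k=\mathrm{prox}_{h^\star/\ell}(\lambda_{k-1}+\frac{Ax_k-b}\ell)$. Output $x_T$. $\mathrm{AGD}(\Psi,y_0,\delta)$ for $L$-smooth $\mu$-strongly convex $\Psi$: $\theta=\frac{\sqrt{L/\mu}-1}{\sqrt{L/\mu}+1}$, $y_{-1}=y_0$; iterate $\tilde y_{k+1}=y_k+\theta(y_k-y_{k-1})$, $y_{k+1}=\tilde y_{k+1}-\frac1L\nabla\Psi(\tilde y_{k+1})$ until $\|\nabla\Psi(y_T)\|\le\mu\delta$; output $y_T$. $\tilde O$ hides universal constants and logarithmic factors in the problem parameters, initial distances and $1/\epsilon$. Gradient evaluations are evaluations of $\nabla f$.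
   Formalization: The factor √L_f·D/√ε in the gradient bound is replaced by max(1, √L_f·D/√ε), since for L_f = 0 the literal bound would be zero evaluations although the algorithm needs some; for ε ≤ L_f D² the bound is unchanged. *)

theory Defs
  imports "HOL-Analysis.Analysis"
begin

subsection \<open>Smooth functions and extended-valued convex functions\<close>

definition grad :: "('a::real_inner \<Rightarrow> real) \<Rightarrow> 'a \<Rightarrow> 'a" where
  "grad f x = (THE d. GDERIV f x :> d)"

definition smooth :: "real \<Rightarrow> ('a::real_inner \<Rightarrow> real) \<Rightarrow> bool" where
  "smooth L f \<longleftrightarrow> (\<forall>x. f differentiable (at x)) \<and> L-lipschitz_on UNIV (grad f)"

definition ereal_epigraph :: "('a \<Rightarrow> ereal) \<Rightarrow> ('a \<times> real) set" where
  "ereal_epigraph h = {(z, t). h z \<le> ereal t}"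

definition proper_closed_convex :: "('a::real_normed_vector \<Rightarrow> ereal) \<Rightarrow> bool" where
  "proper_closed_convex h \<longleftrightarrow>
     (\<forall>z. h z \<noteq> -\<infinity>) \<and> (\<exists>z. h z \<noteq> \<infinity>) \<and>
     closed (ereal_epigraph h) \<and> convex (ereal_epigraph h)"

definition conjugate :: "('a::real_inner \<Rightarrow> ereal) \<Rightarrow> 'a \<Rightarrow> ereal" where
  "conjugate h y = (SUP z. ereal (z \<bullet> y) - h z)"

definition prox :: "('a::real_inner \<Rightarrow> ereal) \<Rightarrow> 'a \<Rightarrow> 'a" where
  "prox g x = (ARG_MIN (\<lambda>u. g u + ereal ((norm (x - u))\<^sup>2 / 2)) u. True)"


subsection \<open>The matrix\<close>

text \<open>
  For an m-by-n matrix of full row rank (so m is at most n), the m singular values are the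
  square roots of the eigenvalues of \<open>A ** transpose A\<close>.
\<close>

definition singular_values :: "real^'n^'m \<Rightarrow> real set" where
  "singular_values A =
     {s. 0 \<le> s \<and> (\<exists>u. u \<noteq> 0 \<and> (A ** transpose A) *v u = s\<^sup>2 *\<^sub>R u)}"

definition min_singular_value :: "real^'n^'m \<Rightarrow> real" where
  "min_singular_value A = Inf (singular_values A)"

definition spectral_norm :: "real^'n^'m \<Rightarrow> real" where
  "spectral_norm A = onorm ((*v) A)"

definition condition_number :: "real^'n^'m \<Rightarrow> real" where
  "condition_number A = spectral_norm A / min_singular_value A"


subsection \<open>The composite problem and its suboptimality measure\<close>

definition objective ::
  "(real^'n \<Rightarrow> real) \<Rightarrow> (real^'m \<Rightarrow> ereal) \<Rightarrow> real^'n^'m \<Rightarrow> real^'m \<Rightarrow> real^'n \<Rightarrow> ereal" where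
  "objective f h A b x = ereal (f x) + h (A *v x - b)"

definition h_trunc :: "real \<Rightarrow> ('a::real_inner \<Rightarrow> ereal) \<Rightarrow> 'a \<Rightarrow> ereal" where
  "h_trunc \<rho> h z = (SUP y\<in>cball 0 \<rho>. ereal (z \<bullet> y) - conjugate h y)"

text \<open>
  The value is extended real: if no point of the ball of radius \<open>\<rho>\<close> lies in the domain of
  \<open>conjugate h\<close>, then \<open>h_trunc \<rho> h\<close> is constantly \<open>-\<infinity>\<close>.
\<close>

definition subopt ::
  "real \<Rightarrow> (real^'n \<Rightarrow> real) \<Rightarrow> (real^'m \<Rightarrow> ereal) \<Rightarrow> real^'n^'m \<Rightarrow> real^'m \<Rightarrow> real^'n \<Rightarrow> ereal" where
  "subopt \<rho> f h A b x =
     ereal (f x) + h_trunc \<rho> h (A *v x - b) - (INF x'. objective f h A b x')"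

definition regularized :: "(real^'n \<Rightarrow> real) \<Rightarrow> real \<Rightarrow> real \<Rightarrow> real^'n \<Rightarrow> real^'n \<Rightarrow> real" where
  "regularized f \<epsilon> D x0 x = f x + \<epsilon> / (2 * D\<^sup>2) * (norm (x - x0))\<^sup>2"


subsection \<open>Accelerated gradient descent\<close>

text \<open>\<open>agd_iter L \<mu> \<Psi> y0 k\<close> is the pair of the iterates with indices \<open>k - 1\<close> and \<open>k\<close>.\<close>

primrec agd_iter ::
  "real \<Rightarrow> real \<Rightarrow> ('a::real_inner \<Rightarrow> real) \<Rightarrow> 'a \<Rightarrow> nat \<Rightarrow> 'a \<times> 'a" where
  "agd_iter L \<mu> \<Psi> y0 0 = (y0, y0)"
| "agd_iter L \<mu> \<Psi> y0 (Suc k) =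
     (let \<theta> = (sqrt (L / \<mu>) - 1) / (sqrt (L / \<mu>) + 1);
          (y', y) = agd_iter L \<mu> \<Psi> y0 k;
          yt = y + \<theta> *\<^sub>R (y - y')
      in (y, yt - (1 / L) *\<^sub>R grad \<Psi> yt))"

text \<open>
  \<open>agd_run L \<mu> \<Psi> y0 \<delta> n y\<close>: the loop started at \<open>y0\<close> stops after exactly \<open>n\<close> iterations with
  output \<open>y\<close>. The stopping test is made after every iteration. As a relation it holds for no
  \<open>n\<close> and \<open>y\<close> if the loop does not terminate.
\<close>

definition agd_run ::
  "real \<Rightarrow> real \<Rightarrow> ('a::real_inner \<Rightarrow> real) \<Rightarrow> 'a \<Rightarrow> real \<Rightarrow> nat \<Rightarrow> 'a \<Rightarrow> bool" where
  "agd_run L \<mu> \<Psi> y0 \<delta> n y \<longleftrightarrow>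
     1 \<le> n \<and> y = snd (agd_iter L \<mu> \<Psi> y0 n) \<and> norm (grad \<Psi> y) \<le> \<mu> * \<delta> \<and>
     (\<forall>j. 1 \<le> j \<and> j < n \<longrightarrow> \<not> norm (grad \<Psi> (snd (agd_iter L \<mu> \<Psi> y0 j))) \<le> \<mu> * \<delta>)"


subsection \<open>Inexact proximal point algorithm\<close>

definition Psi ::
  "(real^'n \<Rightarrow> real) \<Rightarrow> (real^'m \<Rightarrow> ereal) \<Rightarrow> real^'n^'m \<Rightarrow> real^'m \<Rightarrow> real \<Rightarrow> real^'m \<Rightarrow>
   real^'n \<Rightarrow> real" where
  "Psi \<phi> h A b l lam' x =
     \<phi> x + real_of_ereal
       (SUP lam. ereal (lam \<bullet> (A *v x - b)) - conjugate h lam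
                 - ereal (l / 2 * (norm (lam - lam'))\<^sup>2))"

definition mu_Phi :: "real^'n^'m \<Rightarrow> real \<Rightarrow> real" where
  "mu_Phi A L = (min_singular_value A)\<^sup>2 / L"

definition ppa_tolerance :: "real^'n^'m \<Rightarrow> real \<Rightarrow> real \<Rightarrow> real \<Rightarrow> nat \<Rightarrow> real" where
  "ppa_tolerance A L l R k = (1 - mu_Phi A L / (12 * l)) powr (real k / 2) * R"

text \<open>
  \<open>inexact_ppa \<phi> h A b L \<mu> l R x0 lam0 k x lam N\<close>: after \<open>k\<close> outer iterations the algorithm has
  reached the primal-dual pair \<open>(x, lam)\<close>, having evaluated the gradient of \<open>\<phi>\<close> exactly
  \<open>N\<close> times. The gradient of \<open>Psi\<close> at \<open>x\<close> is \<open>grad \<phi> x\<close> plus the transpose of \<open>A\<close> applied to a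
  proximal point, so each of its evaluations costs one evaluation of \<open>grad \<phi>\<close>; for
  \<open>\<phi> = regularized f \<epsilon> D x0\<close> this is one evaluation of \<open>grad f\<close>. An iteration of accelerated
  gradient descent makes two: one at the extrapolated point and one for the stopping test.
\<close>

inductive inexact_ppa ::
  "(real^'n \<Rightarrow> real) \<Rightarrow> (real^'m \<Rightarrow> ereal) \<Rightarrow> real^'n^'m \<Rightarrow> real^'m \<Rightarrow> real \<Rightarrow> real \<Rightarrow> real \<Rightarrow> real \<Rightarrow>
   real^'n \<Rightarrow> real^'m \<Rightarrow> nat \<Rightarrow> real^'n \<Rightarrow> real^'m \<Rightarrow> nat \<Rightarrow> bool"
  for \<phi> h A b L \<mu> l R x0 lam0 where
  init: "inexact_ppa \<phi> h A b L \<mu> l R x0 lam0 0 x0 lam0 0"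
| step: "\<lbrakk>inexact_ppa \<phi> h A b L \<mu> l R x0 lam0 k x lam N;
          agd_run (L + (spectral_norm A)\<^sup>2 / l) \<mu> (Psi \<phi> h A b l lam) x
            (ppa_tolerance A L l R (Suc k)) n x';
          lam' = prox (\<lambda>u. conjugate h u / ereal l) (lam + (1 / l) *\<^sub>R (A *v x' - b))\<rbrakk>
         \<Longrightarrow> inexact_ppa \<phi> h A b L \<mu> l R x0 lam0 (Suc k) x' lam' (N + 2 * n)"

end

theory Submission
  imports Defs
begin

text \<open>
  The inexact proximal point method runs on the dual of the regularized problem, with
  \<open>l = mu_Phi A L\<close>. Full row rank makes the dual strongly convex, so an exact dual step
  contracts by the factor 1/2, and its fixed point is a saddle point. The prescribed tolerances
  decrease slower than that, so by induction the dual error stays proportional to the tolerance,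
  hence so do the primal error and the distance from the starting point of each inner loop to the
  minimizer of \<open>Psi\<close>. Accelerated gradient descent therefore needs, in every outer iteration,
  only \<open>sqrt ((L + (spectral_norm A)\<^sup>2 / l) / \<mu>)\<close>, which is of order
  \<open>condition_number A * sqrt (L / \<mu>)\<close>, times a logarithm.

  At the saddle point \<open>(x, lam)\<close>, \<open>A x - b\<close> is a subgradient of the conjugate at \<open>lam\<close>; this
  bounds \<open>h_trunc\<close> from above and the optimal value from below by the same dual value, without
  biconjugation. A multiplier of the original problem at \<open>xstar\<close> shows that
  the conjugate is proper and that the regularized solution stays within \<open>D\<close> of \<open>x0\<close>.
\<close>

subsection \<open>Functions between two quadratics\<close>

text \<open>Near a solution \<open>h\<close> may be infinite, so the output cannot be judged by the
  objective itself. In \<open>h_trunc\<close> only dual points of norm at most \<rho> compete, so a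
  displacement of the primal point costs at most \<rho> times its image under \<open>A\<close>.
  Hence the outer iteration only has to deliver a small distance to the regularized solution. Half
  of \<epsilon> pays for the regularizer at \<open>xstar\<close>; the linear and the quadratic part
  of the remaining error get a quarter each. The radius \<open>R\<close> must dominate the distance
  from \<open>lam0\<close> to a dual solution that is not known in advance. The least singular value
  and the gradient at the regularized solution bound this distance by problem data, and it enters
  the count only under a logarithm. Smoothness and strong convexity are carried as a pair of
  quadratic bounds with a named gradient map. \<open>Psi\<close> contains a supremum and
  \<open>grad\<close> is a definite description; two-sided bounds can be proved for the supremum
  directly, add up, survive composition with \<open>A\<close>, and yield the gradient
  afterwards.\<close>

definition between_quadratics ::
  "real \<Rightarrow> real \<Rightarrow> ('a::real_inner \<Rightarrow> real) \<Rightarrow> ('a \<Rightarrow> 'a) \<Rightarrow> bool" where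
  "between_quadratics \<mu> L f G \<longleftrightarrow>
     (\<forall>x y. f x + G x \<bullet> (y - x) + \<mu> / 2 * (norm (y - x))\<^sup>2 \<le> f y \<and>
            f y \<le> f x + G x \<bullet> (y - x) + L / 2 * (norm (y - x))\<^sup>2)"

lemma between_quadratics_lower:
  "between_quadratics \<mu> L f G \<Longrightarrow> f x + G x \<bullet> (y - x) + \<mu> / 2 * (norm (y - x))\<^sup>2 \<le> f y"
  by (simp add: between_quadratics_def)

lemma between_quadratics_upper:
  "between_quadratics \<mu> L f G \<Longrightarrow> f y \<le> f x + G x \<bullet> (y - x) + L / 2 * (norm (y - x))\<^sup>2"
  by (simp add: between_quadratics_def)

lemma between_quadratics_mono:
  fixes f :: "'a::real_inner \<Rightarrow> real"
  assumes "between_quadratics \<mu> L f G" "\<mu>' \<le> \<mu>" "L \<le> L'"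
  shows "between_quadratics \<mu>' L' f G"
  unfolding between_quadratics_def
proof (intro allI conjI)
  fix x y :: 'a
  have "\<mu>' / 2 * (norm (y - x))\<^sup>2 \<le> \<mu> / 2 * (norm (y - x))\<^sup>2"
    "L / 2 * (norm (y - x))\<^sup>2 \<le> L' / 2 * (norm (y - x))\<^sup>2"
    using assms by (auto intro!: mult_right_mono)
  then show "f x + G x \<bullet> (y - x) + \<mu>' / 2 * (norm (y - x))\<^sup>2 \<le> f y"
    "f y \<le> f x + G x \<bullet> (y - x) + L' / 2 * (norm (y - x))\<^sup>2"
    using between_quadratics_lower[OF assms(1), of x y]
      between_quadratics_upper[OF assms(1), of y x] by linarith+
qed

lemma between_quadratics_add:
  fixes f g :: "'a::real_inner \<Rightarrow> real"
  assumes "between_quadratics \<mu> L f F" "between_quadratics \<nu> K g G"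
  shows "between_quadratics (\<mu> + \<nu>) (L + K) (\<lambda>x. f x + g x) (\<lambda>x. F x + G x)"
  unfolding between_quadratics_def
proof (intro allI conjI)
  fix x y :: 'a
  show "f x + g x + (F x + G x) \<bullet> (y - x) + (\<mu> + \<nu>) / 2 * (norm (y - x))\<^sup>2 \<le> f y + g y"
    using between_quadratics_lower[OF assms(1), of x y]
      between_quadratics_lower[OF assms(2), of x y]
    by (simp add: inner_add_left algebra_simps add_divide_distrib)
  show "f y + g y \<le> f x + g x + (F x + G x) \<bullet> (y - x) + (L + K) / 2 * (norm (y - x))\<^sup>2"
    using between_quadratics_upper[OF assms(1), of y x]
      between_quadratics_upper[OF assms(2), of y x]
    by (simp add: inner_add_left algebra_simps add_divide_distrib)
qed

lemma between_quadratics_sq_dist: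
  "between_quadratics \<mu> \<mu> (\<lambda>x. \<mu> / 2 * (norm (x - a))\<^sup>2) (\<lambda>x. \<mu> *\<^sub>R (x - a))"
proof -
  have "\<mu> / 2 * (norm (y - a))\<^sup>2
      = \<mu> / 2 * (norm (x - a))\<^sup>2 + (\<mu> *\<^sub>R (x - a)) \<bullet> (y - x) + \<mu> / 2 * (norm (y - x))\<^sup>2" for x y
    unfolding power2_norm_eq_inner
    by (simp add: inner_diff_left inner_diff_right inner_commute field_simps)
  then show ?thesis
    unfolding between_quadratics_def by auto
qed

lemma norm_diff_scaleR_sq:
  fixes a b :: "'a::real_inner"
  shows "(norm (a - c *\<^sub>R b))\<^sup>2 = (norm a)\<^sup>2 - 2 * c * (b \<bullet> a) + c\<^sup>2 * (norm b)\<^sup>2"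
  unfolding power2_norm_eq_inner
  by (simp add: inner_diff_left inner_diff_right inner_commute algebra_simps power2_eq_square)

lemma between_quadratics_gderiv:
  assumes bq: "between_quadratics \<mu> L f G" and "0 \<le> \<mu>"
  shows "GDERIV f x :> G x"
  unfolding gderiv_def
proof (rule has_derivativeI_sandwich[where e = 1 and H = "\<lambda>y. L / 2 * norm (y - x)"])
  show "bounded_linear (\<lambda>h. h \<bullet> G x)"
    by (rule bounded_linear_inner_left)
  show "((\<lambda>y. L / 2 * norm (y - x)) \<longlongrightarrow> 0) (at x)"
    by (auto intro!: tendsto_eq_intros)
  fix y assume "y \<noteq> x"
  have "0 \<le> \<mu> / 2 * (norm (y - x))\<^sup>2" using \<open>0 \<le> \<mu>\<close> by simp
  then have "0 \<le> f y - f x - (y - x) \<bullet> G x"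
    "f y - f x - (y - x) \<bullet> G x \<le> L / 2 * norm (y - x) * norm (y - x)"
    using between_quadratics_lower[OF bq, of x y] between_quadratics_upper[OF bq, of y x]
    by (simp_all add: inner_commute power2_eq_square)
  then show "norm (f y - f x - (y - x) \<bullet> G x) / norm (y - x) \<le> L / 2 * norm (y - x)"
    using \<open>y \<noteq> x\<close> by (simp add: divide_le_eq)
qed simp

lemma grad_eq:
  fixes f :: "'a::real_inner \<Rightarrow> real"
  assumes "GDERIV f x :> d"
  shows "grad f x = d"
  unfolding grad_def
proof (rule the_equality[where P = "\<lambda>d. GDERIV f x :> d", OF assms])
  fix e assume "GDERIV f x :> e"
  with assms have "(\<lambda>h. h \<bullet> e) = (\<lambda>h. h \<bullet> d)"
    unfolding gderiv_def by (metis has_derivative_unique)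
  then have "(e - d) \<bullet> e = (e - d) \<bullet> d" by metis
  then have "(e - d) \<bullet> (e - d) = 0" by (simp only: inner_diff_right diff_self)
  then show "e = d" by simp
qed

text \<open>After subtracting the linear function with slope \<open>G x\<close>, the point
  \<open>x\<close> is a minimizer. The point \<open>z\<close> is a gradient step of length 1/L from
  \<open>y\<close> on that tilted function, and its decrease is what \<open>half\<close> records.
  Adding \<open>half\<close> to its mirror image cancels the function values.\<close>

lemma between_quadratics_cocoercive:
  assumes bq: "between_quadratics \<mu> L f G" and "0 \<le> \<mu>" "0 < L"
  shows "(norm (G x - G y))\<^sup>2 \<le> L * ((G x - G y) \<bullet> (x - y))"
proof -
  have half: "f x + G x \<bullet> (y - x) + (norm (G x - G y))\<^sup>2 / (2 * L) \<le> f y" for x y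
  proof -
    define z where "z = y - (1 / L) *\<^sub>R (G y - G x)"
    have "0 \<le> \<mu> / 2 * (norm (z - x))\<^sup>2" using \<open>0 \<le> \<mu>\<close> by simp
    then have "f x + G x \<bullet> (z - x) \<le> f y + G y \<bullet> (z - y) + L / 2 * (norm (z - y))\<^sup>2"
      using between_quadratics_lower[OF bq, of x z] between_quadratics_upper[OF bq, of z y]
      by linarith
    moreover have "L / 2 * (norm (z - y))\<^sup>2 = (norm (G x - G y))\<^sup>2 / (2 * L)"
      using \<open>0 < L\<close>
      by (simp add: z_def power_mult_distrib norm_minus_commute power2_eq_square)
    moreover have "G x \<bullet> (z - x) - G y \<bullet> (z - y) = G x \<bullet> (y - x) + (norm (G x - G y))\<^sup>2 / L"
      unfolding z_def power2_norm_eq_inner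
      by (simp add: inner_diff_left inner_diff_right inner_commute diff_divide_distrib add_divide_distrib)
    moreover have "(norm (G x - G y))\<^sup>2 / L = 2 * ((norm (G x - G y))\<^sup>2 / (2 * L))"
      by simp
    ultimately show ?thesis by linarith
  qed
  have "(norm (G x - G y))\<^sup>2 / L \<le> (G x - G y) \<bullet> (x - y)"
    using half[of x y] half[of y x] \<open>0 < L\<close>
    by (simp add: norm_minus_commute inner_diff_left inner_diff_right inner_commute field_simps)
  with \<open>0 < L\<close> show ?thesis by (simp add: field_simps)
qed

lemma between_quadratics_lipschitz:
  assumes bq: "between_quadratics \<mu> L f G" and "0 \<le> \<mu>" "0 < L"
  shows "norm (G x - G y) \<le> L * norm (x - y)"
proof -
  have "L * ((G x - G y) \<bullet> (x - y)) \<le> L * (norm (G x - G y) * norm (x - y))"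
    using \<open>0 < L\<close> by (intro mult_left_mono norm_cauchy_schwarz) simp
  with between_quadratics_cocoercive[OF assms, of x y]
  have "norm (G x - G y) * norm (G x - G y) \<le> (L * norm (x - y)) * norm (G x - G y)"
    by (simp add: power2_eq_square mult_ac)
  then show ?thesis
    by (cases "norm (G x - G y) = 0") (use \<open>0 < L\<close> in \<open>auto simp: mult_le_cancel_right\<close>)
qed

lemma between_quadratics_strongly_monotone:
  assumes bq: "between_quadratics \<mu> L f G"
  shows "\<mu> * (norm (x - y))\<^sup>2 \<le> (G x - G y) \<bullet> (x - y)"
  using between_quadratics_lower[OF bq, of x y] between_quadratics_lower[OF bq, of y x]
  by (simp add: norm_minus_commute inner_diff_left inner_diff_right inner_commute field_simps)

lemma between_quadratics_expansive:
  assumes bq: "between_quadratics \<mu> L f G"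
  shows "\<mu> * norm (x - y) \<le> norm (G x - G y)"
proof (cases "x = y")
  case False
  have "\<mu> * norm (x - y) * norm (x - y) \<le> norm (G x - G y) * norm (x - y)"
    using between_quadratics_strongly_monotone[OF bq, of x y]
      norm_cauchy_schwarz[of "G x - G y" "x - y"]
    by (simp add: power2_eq_square mult_ac)
  with False show ?thesis by simp
qed simp

text \<open>A gradient step of length 1/L is a contraction, so the stationary point is its Banach
  fixed point.\<close>

lemma between_quadratics_zero_exists:
  fixes f :: "'a::{real_inner, complete_space} \<Rightarrow> real"
  assumes bq: "between_quadratics \<mu> L f G" and "0 < \<mu>" "\<mu> \<le> L"
  shows "\<exists>x. G x = 0"
proof -
  define S where "S x = x - (1 / L) *\<^sub>R G x" for x
  have L: "0 < L" using assms by simp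
  have contr: "dist (S x) (S y) \<le> sqrt (1 - \<mu> / L) * dist x y" for x y
  proof -
    have "(norm (S x - S y))\<^sup>2
        = (norm (x - y))\<^sup>2 - 2 / L * ((G x - G y) \<bullet> (x - y)) + (norm (G x - G y))\<^sup>2 / L\<^sup>2"
    proof -
      have "S x - S y = (x - y) - (1 / L) *\<^sub>R (G x - G y)"
        by (simp add: S_def algebra_simps)
      then show ?thesis by (simp add: norm_diff_scaleR_sq power_one_over)
    qed
    \<comment> \<open>Cocoercivity lets half of the inner product term absorb the squared gradient
      difference; strong monotonicity then turns the other half into the contraction.\<close>
    also have "\<dots> \<le> (norm (x - y))\<^sup>2 - 1 / L * ((G x - G y) \<bullet> (x - y))"
      using between_quadratics_cocoercive[OF bq _ L, of x y] \<open>0 < \<mu>\<close> L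
      by (simp add: field_simps power2_eq_square)
    also have "\<dots> \<le> (1 - \<mu> / L) * (norm (x - y))\<^sup>2"
      using between_quadratics_strongly_monotone[OF bq, of x y] L by (simp add: field_simps)
    finally show ?thesis
      unfolding dist_norm using real_le_rsqrt[of "norm (S x - S y)" "(1 - \<mu> / L) * (norm (x - y))\<^sup>2"]
      by (simp add: real_sqrt_mult)
  qed
  have "\<exists>!x. S x = x"
    by (rule banach_fix_type[of "sqrt (1 - \<mu> / L)"]) (use assms L contr in auto)
  then obtain x where "S x = x" by blast
  then show ?thesis using L by (auto simp: S_def)
qed

section \<open>From differentiability and convexity to quadratic bounds\<close>

lemma differentiable_imp_grad:
  fixes f :: "'a::euclidean_space \<Rightarrow> real"
  assumes "f differentiable (at x)"
  shows "GDERIV f x :> grad f x"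
proof -
  obtain f' where f': "(f has_derivative f') (at x)"
    using assms by (auto simp: differentiable_def)
  then have lin: "linear f'" by (rule has_derivative_linear)
  define d where "d = (\<Sum>i\<in>Basis. f' i *\<^sub>R i)"
  have "f' h = h \<bullet> d" for h
  proof -
    have "f' h = (\<Sum>i\<in>Basis. (h \<bullet> i) * f' i)"
      by (subst (1) euclidean_representation[symmetric, of h])
        (simp add: linear_sum[OF lin] linear_scale[OF lin])
    then show ?thesis by (simp add: d_def inner_sum_right mult_ac)
  qed
  then have "f' = (\<lambda>h. h \<bullet> d)" by auto
  with f' have "GDERIV f x :> d" by (simp add: gderiv_def)
  with grad_eq show ?thesis by metis
qed

lemma gderiv_along_line:
  fixes f :: "'a::real_inner \<Rightarrow> real"
  assumes "GDERIV f (x + t *\<^sub>R d) :> g"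
  shows "((\<lambda>s. f (x + s *\<^sub>R d)) has_real_derivative g \<bullet> d) (at t)"
proof -
  have "(f has_derivative (\<lambda>h. h \<bullet> g)) (at (x + t *\<^sub>R d))"
    using assms by (simp add: gderiv_def)
  moreover have "((\<lambda>s. x + s *\<^sub>R d) has_derivative (\<lambda>s. s *\<^sub>R d)) (at t)"
    by (auto intro!: derivative_eq_intros)
  ultimately have "((\<lambda>s. f (x + s *\<^sub>R d)) has_derivative (\<lambda>s. (s *\<^sub>R d) \<bullet> g)) (at t)"
    using has_derivative_compose by blast
  then show ?thesis
    by (rule has_derivative_imp_has_field_derivative) (simp add: inner_commute)
qed

lemma convex_smooth_between_quadratics:
  fixes f :: "'a::euclidean_space \<Rightarrow> real"
  assumes cvx: "convex_on UNIV f" and sm: "smooth L f"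
  shows "between_quadratics 0 L f (grad f)"
  unfolding between_quadratics_def
proof (intro allI conjI)
  fix x y :: 'a
  define d where "d = y - x"
  have der: "((\<lambda>s. f (x + s *\<^sub>R d)) has_real_derivative grad f (x + t *\<^sub>R d) \<bullet> d) (at t)" for t
    using sm by (intro gderiv_along_line differentiable_imp_grad) (auto simp: smooth_def)
  have "convex_on UNIV (\<lambda>s. f (x + s *\<^sub>R d))"
  proof (rule convex_onI)
    fix t a b :: real assume "0 < t" "t < 1"
    moreover have "x + ((1 - t) * a + t * b) *\<^sub>R d
        = (1 - t) *\<^sub>R (x + a *\<^sub>R d) + t *\<^sub>R (x + b *\<^sub>R d)"
      by (simp add: algebra_simps)
    ultimately show "f (x + ((1 - t) *\<^sub>R a + t *\<^sub>R b) *\<^sub>R d)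
        \<le> (1 - t) * f (x + a *\<^sub>R d) + t * f (x + b *\<^sub>R d)"
      using convex_onD[OF cvx, of t "x + a *\<^sub>R d" "x + b *\<^sub>R d"] by simp
  qed simp
  from convex_on_imp_above_tangent[OF this _ _ _ der[of 0, simplified], of 1]
  show "f x + grad f x \<bullet> (y - x) + 0 / 2 * (norm (y - x))\<^sup>2 \<le> f y"
    by (simp add: d_def)
  \<comment> \<open>\<open>k\<close> is \<open>f\<close> along the segment minus the non-constant
    part of its quadratic upper model. The Lipschitz gradient makes its derivative nonpositive, and
    comparing the end points gives the upper bound.\<close>
  define k where "k t = f (x + t *\<^sub>R d) - t * (grad f x \<bullet> d) - L * t\<^sup>2 / 2 * (norm d)\<^sup>2" for t
  have "k 0 \<ge> k 1"
  proof (rule DERIV_nonpos_imp_nonincreasing[of 0 1 k])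
    fix t :: real assume t: "0 \<le> t" "t \<le> 1"
    have "(k has_real_derivative
        grad f (x + t *\<^sub>R d) \<bullet> d - grad f x \<bullet> d - L * t * (norm d)\<^sup>2) (at t)"
      unfolding k_def[abs_def]
      by (rule derivative_eq_intros der refl | simp)+
    moreover have "(grad f (x + t *\<^sub>R d) - grad f x) \<bullet> d \<le> L * t * (norm d)\<^sup>2"
    proof -
      have "norm (grad f (x + t *\<^sub>R d) - grad f x) \<le> L * (t * norm d)"
        using sm t lipschitz_on_normD[of L UNIV "grad f" "x + t *\<^sub>R d" x] by (simp add: smooth_def)
      then show ?thesis
        using norm_cauchy_schwarz[of "grad f (x + t *\<^sub>R d) - grad f x" d]
          mult_right_mono[of "norm (grad f (x + t *\<^sub>R d) - grad f x)" "L * (t * norm d)" "norm d"]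
        by (simp add: power2_eq_square mult_ac)
    qed
    ultimately show "\<exists>y. (k has_real_derivative y) (at t) \<and> y \<le> 0"
      by (intro exI conjI) (auto simp: inner_diff_left)
  qed simp
  then show "f y \<le> f x + grad f x \<bullet> (y - x) + L / 2 * (norm (y - x))\<^sup>2"
    by (simp add: k_def d_def)
qed

subsection \<open>Accelerated gradient descent\<close>

text \<open>The usual Lyapunov function: function gap plus the squared distance of an auxiliary
  sequence \<open>z\<close>. Three bounds are added: descent from \<open>x\<close>, convexity
  towards \<open>y\<close> with weight 1 - q, strong convexity towards \<open>xs\<close> with weight
  q. The relation between \<open>x\<close>, \<open>y\<close> and \<open>z\<close> makes all terms
  linear in the gradient cancel, and \<open>q\<^sup>2 = \<mu> / L\<close> makes the squared
  gradients cancel.\<close>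

lemma agd_potential_step:
  fixes x y z g xs :: "'a::real_inner"
  assumes bq: "between_quadratics \<mu> L \<Psi> G" and "0 < \<mu>" "0 < L"
    and q: "0 < q" "q \<le> 1" "q\<^sup>2 = \<mu> / L"
    and x: "(1 + q) *\<^sub>R x = y + q *\<^sub>R z"
  shows "\<Psi> (x - (1 / L) *\<^sub>R G x) - \<Psi> xs
         + \<mu> / 2 * (norm ((1 - q) *\<^sub>R z + q *\<^sub>R x - (q / \<mu>) *\<^sub>R G x - xs))\<^sup>2
       \<le> (1 - q) * (\<Psi> y - \<Psi> xs + \<mu> / 2 * (norm (z - xs))\<^sup>2)"
proof -
  define a where "a = z - xs"
  define c where "c = x - xs"
  define g where "g = G x"
  have y: "y - x = q *\<^sub>R (c - a)"
    using x by (simp add: a_def c_def algebra_simps)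
  have 1: "\<Psi> (x - (1 / L) *\<^sub>R g) \<le> \<Psi> x - (norm g)\<^sup>2 / (2 * L)"
    using between_quadratics_upper[OF bq, of "x - (1 / L) *\<^sub>R g" x] \<open>0 < L\<close>
    by (simp add: g_def power2_norm_eq_inner[symmetric] power_mult_distrib power2_eq_square field_simps)
  have "0 \<le> \<mu> / 2 * (norm (y - x))\<^sup>2" using \<open>0 < \<mu>\<close> by simp
  then have "\<Psi> x + g \<bullet> (y - x) \<le> \<Psi> y"
    using between_quadratics_lower[OF bq, of x y] by (simp add: g_def)
  then have 2: "(1 - q) * (\<Psi> x + q * (g \<bullet> c - g \<bullet> a)) \<le> (1 - q) * \<Psi> y"
    using q unfolding y by (intro mult_left_mono) (simp_all add: inner_diff_right)
  have "\<Psi> x - g \<bullet> c + \<mu> / 2 * (norm c)\<^sup>2 \<le> \<Psi> xs"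
    using between_quadratics_lower[OF bq, of x xs]
    by (simp add: g_def c_def norm_minus_commute inner_diff_right)
  then have 3: "q * (\<Psi> x - g \<bullet> c + \<mu> / 2 * (norm c)\<^sup>2) \<le> q * \<Psi> xs"
    using q by (intro mult_left_mono) auto
  define w where "w = (1 - q) *\<^sub>R a + q *\<^sub>R c"
  have "(1 - q) *\<^sub>R z + q *\<^sub>R x - (q / \<mu>) *\<^sub>R g - xs = w - (q / \<mu>) *\<^sub>R g"
    by (simp add: w_def a_def c_def algebra_simps)
  then have 4: "\<mu> / 2 * (norm ((1 - q) *\<^sub>R z + q *\<^sub>R x - (q / \<mu>) *\<^sub>R g - xs))\<^sup>2
      = \<mu> / 2 * (norm w)\<^sup>2 - q * (g \<bullet> w) + (norm g)\<^sup>2 / (2 * L)"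
    using \<open>0 < \<mu>\<close> \<open>0 < L\<close> q(3)
  proof -
    have "\<mu> * (q / \<mu>)\<^sup>2 = 1 / L"
      using \<open>0 < \<mu>\<close> \<open>0 < L\<close> q(3) by (simp add: power_divide power2_eq_square)
    then have "\<mu> / 2 * ((q / \<mu>)\<^sup>2 * (norm g)\<^sup>2) = (norm g)\<^sup>2 / (2 * L)"
      by (simp add: mult.assoc[symmetric])
    then show ?thesis
      unfolding \<open>(1 - q) *\<^sub>R z + q *\<^sub>R x - (q / \<mu>) *\<^sub>R g - xs = w - (q / \<mu>) *\<^sub>R g\<close>
      using \<open>0 < \<mu>\<close> by (simp add: norm_diff_scaleR_sq distrib_left right_diff_distrib)
  qed
  have "(norm w)\<^sup>2 = (1 - q) * (norm a)\<^sup>2 + q * (norm c)\<^sup>2 - q * (1 - q) * (norm (a - c))\<^sup>2"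
    unfolding w_def power2_norm_eq_inner
    by (simp add: inner_diff_left inner_diff_right inner_add_left inner_add_right inner_commute
        algebra_simps)
  moreover have "0 \<le> q * (1 - q) * (norm (a - c))\<^sup>2" using q by simp
  ultimately have "\<mu> / 2 * (norm w)\<^sup>2 \<le> \<mu> / 2 * ((1 - q) * (norm a)\<^sup>2 + q * (norm c)\<^sup>2)"
    using \<open>0 < \<mu>\<close> by (intro mult_left_mono) auto
  moreover have "q * (g \<bullet> w) = q * ((1 - q) * (g \<bullet> a) + q * (g \<bullet> c))"
    by (simp add: w_def inner_add_right)
  ultimately show ?thesis
    using 1 2 3 unfolding g_def[symmetric] 4 a_def[symmetric]
    by (simp add: algebra_simps diff_divide_distrib)
qed

text \<open>
  For iterates \<open>y'\<close>, \<open>y\<close>, the point \<open>z = y + (1 / q - 1) (y - y')\<close> in the potential is the one for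
  which the extrapolated point equals \<open>(y + q z) / (1 + q)\<close>.
\<close>

lemma agd_potential:
  fixes y0 xs :: "'a::real_inner"
  assumes bq: "between_quadratics \<mu> L \<Psi> G" and "0 < \<mu>" "\<mu> \<le> L"
    and q: "q = sqrt (\<mu> / L)"
  shows "\<Psi> (snd (agd_iter L \<mu> \<Psi> y0 n)) - \<Psi> xs
       + \<mu> / 2 * (norm (snd (agd_iter L \<mu> \<Psi> y0 n)
           + (1 / q - 1) *\<^sub>R (snd (agd_iter L \<mu> \<Psi> y0 n) - fst (agd_iter L \<mu> \<Psi> y0 n)) - xs))\<^sup>2
     \<le> (1 - q) ^ n * (\<Psi> y0 - \<Psi> xs + \<mu> / 2 * (norm (y0 - xs))\<^sup>2)"
proof (induction n)
  case (Suc n)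
  have q': "0 < q" "q \<le> 1" "q\<^sup>2 = \<mu> / L" and L: "0 < L"
    using assms by auto
  obtain y' y where yy: "agd_iter L \<mu> \<Psi> y0 n = (y', y)" by fastforce
  define z where "z = y + (1 / q - 1) *\<^sub>R (y - y')"
  define \<theta> where "\<theta> = (1 - q) / (1 + q)"
  define x where "x = y + \<theta> *\<^sub>R (y - y')"
  \<comment> \<open>In terms of q the momentum parameter of the algorithm is (1 - q) / (1 + q),
    which is what places the extrapolated point at the required combination of \<open>y\<close> and
    \<open>z\<close>.\<close>
  have "sqrt (L / \<mu>) = 1 / q"
    by (simp add: q real_sqrt_divide)
  then have "(sqrt (L / \<mu>) - 1) / (sqrt (L / \<mu>) + 1) = \<theta>"
  proof -
    have "1 / q - 1 = (1 - q) / q" "1 / q + 1 = (1 + q) / q" using q' by (simp_all add: field_simps)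
    then show ?thesis using q' \<open>sqrt (L / \<mu>) = 1 / q\<close> by (simp add: \<theta>_def)
  qed
  moreover have "grad \<Psi> x = G x"
    using between_quadratics_gderiv[OF bq] \<open>0 < \<mu>\<close> by (intro grad_eq) simp
  ultimately have iter: "agd_iter L \<mu> \<Psi> y0 (Suc n) = (y, x - (1 / L) *\<^sub>R G x)"
    by (simp add: yy Let_def x_def)
  have "(1 + q) * \<theta> = 1 - q"
    using q' by (simp add: \<theta>_def)
  then have x: "(1 + q) *\<^sub>R x = y + q *\<^sub>R z"
    using q' by (simp add: x_def z_def scaleR_add_right scaleR_add_left
        right_diff_distrib)
  define yp where "yp = x - (1 / L) *\<^sub>R G x"
  \<comment> \<open>The new auxiliary point is computed after multiplication by q, which clears 1/q;
    then \<open>y\<close> is eliminated through the relation for \<open>x\<close>.\<close>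
  have "q *\<^sub>R (yp + (1 / q - 1) *\<^sub>R (yp - y)) = yp - (1 - q) *\<^sub>R y"
    using q' by (simp add: algebra_simps)
  also have "\<dots> = q *\<^sub>R ((1 - q) *\<^sub>R z + q *\<^sub>R x - (q / \<mu>) *\<^sub>R G x)"
  proof -
    have y: "y = (1 + q) *\<^sub>R x - q *\<^sub>R z" using x by simp
    have "1 / L = q * (q / \<mu>)"
      using q' \<open>0 < \<mu>\<close> by (simp add: power2_eq_square field_simps)
    then show ?thesis unfolding yp_def by (subst y) (simp add: algebra_simps)
  qed
  finally have "yp + (1 / q - 1) *\<^sub>R (yp - y) = (1 - q) *\<^sub>R z + q *\<^sub>R x - (q / \<mu>) *\<^sub>R G x"
    using q' by (simp only: scaleR_cancel_left) simp
  with agd_potential_step[OF bq \<open>0 < \<mu>\<close> L q' x, of xs]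
  have "\<Psi> yp - \<Psi> xs + \<mu> / 2 * (norm (yp + (1 / q - 1) *\<^sub>R (yp - y) - xs))\<^sup>2
      \<le> (1 - q) * (\<Psi> y - \<Psi> xs + \<mu> / 2 * (norm (z - xs))\<^sup>2)"
    by (simp add: yp_def)
  also have "\<dots> \<le> (1 - q) * ((1 - q) ^ n * (\<Psi> y0 - \<Psi> xs + \<mu> / 2 * (norm (y0 - xs))\<^sup>2))"
    using Suc.IH q' by (intro mult_left_mono) (auto simp: yy z_def)
  finally show ?case
    by (simp only: iter fst_conv snd_conv yp_def[symmetric] power_Suc mult.assoc)
qed simp

lemma agd_run_exists:
  fixes y0 xs :: "'a::real_inner"
  assumes bq: "between_quadratics \<mu> L \<Psi> G" and \<mu>: "0 < \<mu>" "\<mu> \<le> L"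
    and xs: "G xs = 0" and "0 < \<delta>" and "1 \<le> d" and d: "norm (y0 - xs) \<le> d * \<delta>"
  shows "\<exists>n y. agd_run L \<mu> \<Psi> y0 \<delta> n y \<and>
    real n \<le> sqrt (L / \<mu>) * ln (2 * (L / \<mu> * d)\<^sup>2) + 1"
proof -
  define q where "q = sqrt (\<mu> / L)"
  have q: "0 < q" "q \<le> 1" and L: "0 < L" using \<mu> by (auto simp: q_def)
  have sq: "sqrt (L / \<mu>) = 1 / q" by (simp add: q_def real_sqrt_divide)
  \<comment> \<open>\<open>X\<close> is the factor by which the potential must drop. Initially it is
    at most L (d \<delta>)^2, and the squared gradient is at most 2 L times the function gap, so 2
    L^2 (d \<delta>)^2 / X should equal (\<mu> \<delta>)^2. As \<open>X\<close> is at least 2, its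
    logarithm is positive and at least one iteration is counted, as \<open>agd_run\<close>
    demands.\<close>
  define X where "X = 2 * (L / \<mu> * d)\<^sup>2"
  have "1 * 1 \<le> L / \<mu> * d" using \<mu> \<open>1 \<le> d\<close> by (intro mult_mono) auto
  then have "1 \<le> (L / \<mu> * d)\<^sup>2" by simp
  then have X: "2 \<le> X" by (simp add: X_def)
  define n where "n = nat \<lceil>ln X / q\<rceil>"
  have lnX: "0 < ln X / q" using X q by simp
  then have n: "1 \<le> n" "ln X / q \<le> real n" "real n \<le> ln X / q + 1"
    unfolding n_def by linarith+
  define y where "y = snd (agd_iter L \<mu> \<Psi> y0 n)"
  have grad: "grad \<Psi> x = G x" for x
    using between_quadratics_gderiv[OF bq] \<open>0 < \<mu>\<close> by (intro grad_eq) simp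
  have "\<Psi> y - \<Psi> xs \<le> (1 - q) ^ n * (\<Psi> y0 - \<Psi> xs + \<mu> / 2 * (norm (y0 - xs))\<^sup>2)"
  proof -
    have "0 \<le> \<mu> / 2 * (norm (y + (1 / q - 1) *\<^sub>R (y - fst (agd_iter L \<mu> \<Psi> y0 n)) - xs))\<^sup>2"
      using \<mu> by simp
    then show ?thesis
      using agd_potential[OF bq \<mu> q_def, of y0 n xs] unfolding y_def by linarith
  qed
  also have "\<dots> \<le> (1 / X) * (L * (d * \<delta>)\<^sup>2)"
  proof (rule mult_mono)
    have "(1 - q) ^ n \<le> exp (- q) ^ n"
      using exp_ge_add_one_self[of "- q"] q by (intro power_mono) auto
    also have "\<dots> = exp (- (q * real n))"
      by (simp add: exp_of_nat_mult[symmetric] mult.commute)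
    also have "\<dots> \<le> exp (- ln X)"
      using n(2) q by (simp add: field_simps)
    finally show "(1 - q) ^ n \<le> 1 / X"
      using X by (simp add: exp_minus divide_inverse)
    have "\<Psi> y0 - \<Psi> xs \<le> L / 2 * (norm (y0 - xs))\<^sup>2"
      using between_quadratics_upper[OF bq, of y0 xs] xs by simp
    moreover have "\<mu> / 2 * (norm (y0 - xs))\<^sup>2 \<le> L / 2 * (norm (y0 - xs))\<^sup>2"
      using \<mu> by (intro mult_right_mono) auto
    ultimately have "\<Psi> y0 - \<Psi> xs + \<mu> / 2 * (norm (y0 - xs))\<^sup>2 \<le> L * (norm (y0 - xs))\<^sup>2"
      by simp
    also have "\<dots> \<le> L * (d * \<delta>)\<^sup>2"
      using L d by (intro mult_left_mono power_mono) auto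
    finally show "\<Psi> y0 - \<Psi> xs + \<mu> / 2 * (norm (y0 - xs))\<^sup>2 \<le> L * (d * \<delta>)\<^sup>2" .
    have "0 \<le> \<mu> / 2 * (norm (y0 - xs))\<^sup>2" using \<mu> by simp
    then show "0 \<le> \<Psi> y0 - \<Psi> xs + \<mu> / 2 * (norm (y0 - xs))\<^sup>2"
      using between_quadratics_lower[OF bq, of xs y0] xs by simp
  qed (use X in simp)
  finally have y1: "\<Psi> y - \<Psi> xs \<le> (1 / X) * (L * (d * \<delta>)\<^sup>2)" .
  \<comment> \<open>One more gradient step from \<open>y\<close> cannot go below the minimum, so the
    function gap controls the gradient norm, the quantity that is tested.\<close>
  have "0 \<le> \<mu> / 2 * (norm (y - (1 / L) *\<^sub>R G y - xs))\<^sup>2" using \<mu> by simp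
  then have "\<Psi> xs \<le> \<Psi> (y - (1 / L) *\<^sub>R G y)"
    using between_quadratics_lower[OF bq, of xs "y - (1 / L) *\<^sub>R G y"] xs by simp
  moreover have "\<Psi> (y - (1 / L) *\<^sub>R G y) \<le> \<Psi> y - (norm (G y))\<^sup>2 / (2 * L)"
    using between_quadratics_upper[OF bq, of "y - (1 / L) *\<^sub>R G y" y] L
    by (simp add: power2_norm_eq_inner[symmetric] power_mult_distrib power2_eq_square field_simps)
  ultimately have "(norm (G y))\<^sup>2 / (2 * L) \<le> (1 / X) * (L * (d * \<delta>)\<^sup>2)"
    using y1 by linarith
  then have "(norm (G y))\<^sup>2 \<le> 2 * L * ((1 / X) * (L * (d * \<delta>)\<^sup>2))"
    using L by (simp add: field_simps)
  moreover have "2 * L * ((1 / X) * (L * (d * \<delta>)\<^sup>2)) = (\<mu> * \<delta>)\<^sup>2"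
  proof -
    have "X * (\<mu> * \<delta>)\<^sup>2 = 2 * (L / \<mu> * d * (\<mu> * \<delta>))\<^sup>2"
      unfolding X_def by (simp only: power_mult_distrib mult.assoc)
    also have "L / \<mu> * d * (\<mu> * \<delta>) = L * (d * \<delta>)"
      using \<mu> by simp
    finally have "(\<mu> * \<delta>)\<^sup>2 = 2 * (L * (d * \<delta>))\<^sup>2 / X"
      using X by (simp add: field_simps)
    then show ?thesis
      by (simp add: power_mult_distrib[of L] power2_eq_square[of L])
  qed
  ultimately have "(norm (G y))\<^sup>2 \<le> (\<mu> * \<delta>)\<^sup>2"
    by simp
  then have "norm (G y) \<le> \<mu> * \<delta>"
    using \<mu> \<open>0 < \<delta>\<close> power2_le_imp_le[of "norm (G y)" "\<mu> * \<delta>"] by simp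
  \<comment> \<open>The test succeeds at \<open>n\<close>, but it may succeed earlier;
    \<open>agd_run\<close> stops at the first success.\<close>
  define ok where "ok j \<longleftrightarrow> 1 \<le> j \<and> norm (grad \<Psi> (snd (agd_iter L \<mu> \<Psi> y0 j))) \<le> \<mu> * \<delta>" for j
  have "ok n"
    using n \<open>norm (G y) \<le> \<mu> * \<delta>\<close> by (simp add: ok_def y_def grad)
  define m where "m = (LEAST j. ok j)"
  have "ok m"
    unfolding m_def using \<open>ok n\<close> by (rule LeastI)
  have "m \<le> n"
    unfolding m_def using \<open>ok n\<close> by (rule Least_le)
  have "\<not> ok j" if "j < m" for j
    using not_less_Least that unfolding m_def .
  then have "agd_run L \<mu> \<Psi> y0 \<delta> m (snd (agd_iter L \<mu> \<Psi> y0 m))"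
    using \<open>ok m\<close> by (simp add: agd_run_def ok_def)
  moreover have "real m \<le> sqrt (L / \<mu>) * ln (2 * (L / \<mu> * d)\<^sup>2) + 1"
    using \<open>m \<le> n\<close> n(3) by (simp add: sq X_def)
  ultimately show ?thesis by blast
qed

subsection \<open>Proximal points and the Moreau envelope\<close>

text \<open>Finiteness at the base point is built in, so that two subgradient inequalities can be
  added in the reals.\<close>

definition has_subgradient :: "('a::real_inner \<Rightarrow> ereal) \<Rightarrow> 'a \<Rightarrow> 'a \<Rightarrow> bool" where
  "has_subgradient g p d \<longleftrightarrow> (\<exists>r. g p = ereal r \<and> (\<forall>u. ereal (r + d \<bullet> (u - p)) \<le> g u))"

lemma has_subgradient_monotone:
  assumes "has_subgradient g p d" "has_subgradient g p' d'"
  shows "0 \<le> (d - d') \<bullet> (p - p')"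
proof -
  obtain r r' where r: "g p = ereal r" "\<And>u. ereal (r + d \<bullet> (u - p)) \<le> g u"
    and r': "g p' = ereal r'" "\<And>u. ereal (r' + d' \<bullet> (u - p')) \<le> g u"
    using assms by (auto simp: has_subgradient_def)
  show ?thesis
    using r(2)[of p'] r'(2)[of p] unfolding r(1) r'(1)
    by (simp add: inner_diff_left inner_diff_right)
qed

text \<open>First-order optimality without a derivative: divide by s and let s tend to 0. It serves
  both the proximal problem and the extremal singular vector.\<close>

lemma linear_coeff_nonneg:
  fixes a c :: real
  assumes "\<And>s. 0 < s \<Longrightarrow> s \<le> 1 \<Longrightarrow> 0 \<le> s * a + s\<^sup>2 * c"
  shows "0 \<le> a"
proof (rule ccontr)
  assume "\<not> 0 \<le> a"
  then have a: "a < 0" by simp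
  \<comment> \<open>Small enough that s * c is at most -a/2, so the linear term dominates.\<close>
  define s where "s = min 1 (- a / (2 * (\<bar>c\<bar> + 1)))"
  have s: "0 < s" "s \<le> 1" using a by (auto simp: s_def intro!: divide_neg_pos)
  have "s * c \<le> s * (\<bar>c\<bar> + 1)" using s by (intro mult_left_mono) auto
  also have "s * (\<bar>c\<bar> + 1) \<le> - a / (2 * (\<bar>c\<bar> + 1)) * (\<bar>c\<bar> + 1)"
    by (intro mult_right_mono) (auto simp: s_def)
  also have "\<dots> = - a / 2" by (simp add: field_simps)
  finally have "s * (a + s * c) < 0"
    using a s by (intro mult_pos_neg) auto
  with assms[OF s] show False by (simp add: algebra_simps power2_eq_square)
qed

text \<open>Minimizing over the epigraph replaces a lower semicontinuous extended-valued function by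
  the continuous \<open>J\<close> on a closed set. The affine minorant makes a sublevel set bounded,
  hence compact. Existence matters because \<open>prox\<close> is a choice operator.\<close>

lemma prox_minimizer_exists:
  fixes g :: "'a::euclidean_space \<Rightarrow> ereal"
  assumes pcc: "proper_closed_convex g" and minor: "\<And>u. ereal (a \<bullet> u + c) \<le> g u" and "0 < l"
  shows "\<exists>p. \<forall>u. g p / ereal l + ereal ((norm (v - p))\<^sup>2 / 2)
    \<le> g u / ereal l + ereal ((norm (v - u))\<^sup>2 / 2)"
proof -
  obtain u0 where "g u0 \<noteq> \<infinity>" "g u0 \<noteq> -\<infinity>"
    using pcc by (auto simp: proper_closed_convex_def)
  then obtain t0 where t0: "g u0 = ereal t0" by (cases "g u0") auto
  define J where "J w = snd w / l + (norm (v - fst w))\<^sup>2 / 2" for w :: "'a \<times> real"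
  define J0 where "J0 = J (u0, t0)"
  define S where "S = ereal_epigraph g \<inter> {w. J w \<le> J0}"
  have contJ: "continuous_on X J" for X
    unfolding J_def[abs_def] by (intro continuous_intros) (use \<open>0 < l\<close> in auto)
  have "closed S"
    using pcc unfolding S_def proper_closed_convex_def
    by (intro closed_Int closed_Collect_le contJ) auto
  moreover have "bounded S"
  proof -
    \<comment> \<open>The minorant turns the sublevel condition into r^2 <= C + (2 |a| / l) r for
      the distance r from \<open>v\<close>. If r exceeded \<open>B\<close>, which is at least 1,
      then r^2 > B r would already exceed the right side.\<close>
    define C where "C = 2 * J0 - 2 * (a \<bullet> v + c) / l"
    define B where "B = 1 + \<bar>C\<bar> + 2 * norm a / l"
    have "S \<subseteq> cball v B \<times> {a \<bullet> v - norm a * B + c .. l * J0}"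
    proof
      fix w assume "w \<in> S"
      then obtain u t where w: "w = (u, t)" and gt: "g u \<le> ereal t" and J: "J (u, t) \<le> J0"
        by (cases w) (auto simp: S_def ereal_epigraph_def)
      define r where "r = norm (u - v)"
      have "ereal (a \<bullet> u + c) \<le> ereal t" using minor[of u] gt by (rule order_trans)
      then have t: "a \<bullet> u + c \<le> t" by simp
      have au: "a \<bullet> v - norm a * r \<le> a \<bullet> u"
        using norm_cauchy_schwarz[of a "v - u"] by (simp add: r_def norm_minus_commute inner_diff_right)
      have "(a \<bullet> v - norm a * r + c) / l \<le> t / l"
        using t au \<open>0 < l\<close> by (intro divide_right_mono) auto
      then have r2: "r\<^sup>2 \<le> C + 2 * norm a / l * r"
        using J by (simp add: J_def C_def r_def norm_minus_commute diff_divide_distrib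
            add_divide_distrib)
      have "r \<le> B"
      proof (rule ccontr)
        assume "\<not> r \<le> B"
        moreover have "1 \<le> B" using \<open>0 < l\<close> by (simp add: B_def)
        ultimately have r: "B < r" "1 \<le> r" by auto
        have "\<bar>C\<bar> * 1 \<le> \<bar>C\<bar> * r" using r by (intro mult_left_mono) auto
        moreover have "B * r < r * r" using r by (intro mult_strict_right_mono) auto
        ultimately show False
          using r2 r by (simp add: B_def power2_eq_square distrib_right)
      qed
      moreover have "norm a * r \<le> norm a * B" using \<open>r \<le> B\<close> by (intro mult_left_mono) auto
      moreover have "t \<le> l * J0"
      proof -
        have "t / l \<le> J0" using J zero_le_power2[of "norm (v - u)"] unfolding J_def fst_conv snd_conv by linarith
        then show ?thesis using \<open>0 < l\<close> by (simp add: field_simps)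
      qed
      ultimately show "w \<in> cball v B \<times> {a \<bullet> v - norm a * B + c .. l * J0}"
        using t au by (simp add: w r_def dist_norm norm_minus_commute)
    qed
    then show ?thesis
      by (rule bounded_subset[rotated]) (intro bounded_Times bounded_cball bounded_closed_interval)
  qed
  ultimately have "compact S" by (simp add: compact_eq_bounded_closed)
  moreover have S0: "(u0, t0) \<in> S" by (simp add: S_def J0_def ereal_epigraph_def t0)
  ultimately obtain w where "w \<in> S" and min: "\<And>w'. w' \<in> S \<Longrightarrow> J w \<le> J w'"
    using continuous_attains_inf[of S J] contJ by blast
  obtain p t where w: "w = (p, t)" by (cases w)
  have gp: "g p \<le> ereal t" using \<open>w \<in> S\<close> by (simp add: S_def ereal_epigraph_def w)
  show ?thesis
  proof (intro exI allI)
    fix u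
    show "g p / ereal l + ereal ((norm (v - p))\<^sup>2 / 2)
        \<le> g u / ereal l + ereal ((norm (v - u))\<^sup>2 / 2)"
    proof (cases "g u")
      case (real s)
      have "J w \<le> J (u, s)"
      proof (cases "J (u, s) \<le> J0")
        case True
        then show ?thesis by (intro min) (simp add: S_def ereal_epigraph_def real)
      next
        case False
        then show ?thesis using min[OF S0] by (simp add: J0_def)
      qed
      moreover have "g p / ereal l \<le> ereal t / ereal l"
        using gp \<open>0 < l\<close> by (intro ereal_divide_right_mono) auto
      ultimately show ?thesis
        using add_right_mono[of "g p / ereal l" "ereal t / ereal l" "ereal ((norm (v - p))\<^sup>2 / 2)"]
        using \<open>0 < l\<close> by (auto simp: J_def w real intro: order_trans)
    next
      case PInf
      then show ?thesis using \<open>0 < l\<close> by simp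
    next
      case MInf
      then show ?thesis using pcc by (simp add: proper_closed_convex_def)
    qed
  qed
qed

text \<open>Move from \<open>p\<close> a fraction s towards \<open>u\<close>. Convexity of the
  epigraph bounds the change of \<open>g\<close> linearly in s, the squared distance adds a linear
  and an s^2 term, and minimality makes the linear coefficient nonnegative.\<close>

lemma prox_has_subgradient:
  fixes g :: "'a::euclidean_space \<Rightarrow> ereal"
  assumes pcc: "proper_closed_convex g" and minor: "\<And>u. ereal (a \<bullet> u + c) \<le> g u" and "0 < l"
    and p: "p = prox (\<lambda>u. g u / ereal l) v"
  shows "has_subgradient g p (l *\<^sub>R (v - p))"
proof -
  have "\<exists>p. is_arg_min (\<lambda>u. g u / ereal l + ereal ((norm (v - u))\<^sup>2 / 2)) (\<lambda>_. True) p"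
    using prox_minimizer_exists[OF pcc minor \<open>0 < l\<close>, of v] by (simp add: is_arg_min_linorder)
  from someI_ex[OF this]
  have min: "g p / ereal l + ereal ((norm (v - p))\<^sup>2 / 2)
      \<le> g u / ereal l + ereal ((norm (v - u))\<^sup>2 / 2)" for u
    unfolding p prox_def arg_min_def is_arg_min_linorder by blast
  obtain u0 where u0: "g u0 \<noteq> \<infinity>" and ninf: "\<And>u. g u \<noteq> -\<infinity>"
    using pcc by (auto simp: proper_closed_convex_def)
  have "g p \<noteq> \<infinity>"
  proof
    assume "g p = \<infinity>"
    with min[of u0] u0 ninf[of u0] \<open>0 < l\<close> show False by (cases "g u0") auto
  qed
  with ninf[of p] obtain r where r: "g p = ereal r" by (cases "g p") auto
  have "ereal (r + (l *\<^sub>R (v - p)) \<bullet> (u - p)) \<le> g u" for u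
  proof (cases "g u")
    case (real t)
    have "0 \<le> (t - r) / l - (v - p) \<bullet> (u - p)"
    proof (rule linear_coeff_nonneg)
      fix s :: real assume s: "0 < s" "s \<le> 1"
      have "(p, r) \<in> ereal_epigraph g" "(u, t) \<in> ereal_epigraph g"
        by (auto simp: ereal_epigraph_def r real)
      moreover have "convex (ereal_epigraph g)" using pcc by (simp add: proper_closed_convex_def)
      ultimately have "(1 - s) *\<^sub>R (p, r) + s *\<^sub>R (u, t) \<in> ereal_epigraph g"
        using s by (intro convexD_alt) auto
      moreover have "(1 - s) *\<^sub>R p + s *\<^sub>R u = p + s *\<^sub>R (u - p)"
        by (simp add: algebra_simps)
      ultimately have le: "g (p + s *\<^sub>R (u - p)) \<le> ereal ((1 - s) * r + s * t)"
        by (simp add: ereal_epigraph_def)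
      have prox_le: "ereal r / ereal l + ereal ((norm (v - p))\<^sup>2 / 2)
          \<le> ereal ((1 - s) * r + s * t) / ereal l
            + ereal ((norm (v - (p + s *\<^sub>R (u - p))))\<^sup>2 / 2)"
        using order_trans[OF min[of "p + s *\<^sub>R (u - p)"]
            add_right_mono[OF ereal_divide_right_mono[OF le, of "ereal l"]]] \<open>0 < l\<close>
        by (simp add: r)
      define X where "X = (v - p) \<bullet> (u - p)"
      define Q where "Q = (t - r) / l"
      have "r / l + (norm (v - p))\<^sup>2 / 2
          \<le> ((1 - s) * r + s * t) / l + (norm ((v - p) - s *\<^sub>R (u - p)))\<^sup>2 / 2"
        using prox_le \<open>0 < l\<close> by (simp add: diff_diff_eq)
      moreover have "((1 - s) * r + s * t) / l = r / l + s * Q"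
        using \<open>0 < l\<close> by (simp add: Q_def field_simps)
      moreover have "(norm ((v - p) - s *\<^sub>R (u - p)))\<^sup>2
          = (norm (v - p))\<^sup>2 - 2 * s * X + s\<^sup>2 * (norm (u - p))\<^sup>2"
        by (simp add: norm_diff_scaleR_sq X_def inner_commute)
      ultimately have "0 \<le> s * Q - s * X + s\<^sup>2 * (norm (u - p))\<^sup>2 / 2"
        by linarith
      then show "0 \<le> s * ((t - r) / l - (v - p) \<bullet> (u - p)) + s\<^sup>2 * ((norm (u - p))\<^sup>2 / 2)"
        by (simp add: X_def Q_def right_diff_distrib)
    qed
    then have "0 \<le> l * ((t - r) / l - (v - p) \<bullet> (u - p))" using \<open>0 < l\<close> by simp
    also have "\<dots> = t - r - l * ((v - p) \<bullet> (u - p))"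
      using \<open>0 < l\<close> by (simp add: right_diff_distrib diff_divide_distrib)
    finally show ?thesis by (simp add: real)
  qed (use ninf in auto)
  with r show ?thesis by (auto simp: has_subgradient_def)
qed

text \<open>The epigraph of a conjugate is an intersection of half-spaces, one for each point at
  which \<open>h\<close> is finite, so it is closed and convex. The points \<open>z0\<close> and
  \<nu> supply properness.\<close>

lemma proper_closed_convex_conjugate:
  fixes h :: "'a::euclidean_space \<Rightarrow> ereal"
  assumes ninf: "\<And>z. h z \<noteq> -\<infinity>" and z0: "h z0 \<noteq> \<infinity>" and \<nu>: "conjugate h \<nu> \<noteq> \<infinity>"
  shows "proper_closed_convex (conjugate h)"
proof -
  define H where "H z = {w. ereal (z \<bullet> fst w) - h z \<le> ereal (snd w)}" for z
  have epi: "ereal_epigraph (conjugate h) = (\<Inter>z. H z)"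
    by (auto simp: ereal_epigraph_def conjugate_def H_def SUP_le_iff)
  have H: "closed (H z) \<and> convex (H z)" for z
  proof (cases "h z")
    case (real r)
    then have "H z = {w. (z, -1) \<bullet> w \<le> r}"
      by (auto simp: H_def)
    then show ?thesis by (simp add: closed_halfspace_le convex_halfspace_le)
  qed (use ninf in \<open>auto simp: H_def\<close>)
  have "conjugate h y \<noteq> -\<infinity>" for y
  proof -
    have "ereal (z0 \<bullet> y) - h z0 \<le> conjugate h y"
      unfolding conjugate_def by (rule SUP_upper) simp
    with z0 ninf[of z0] show ?thesis by (cases "h z0") auto
  qed
  with \<nu> H show ?thesis
    unfolding proper_closed_convex_def epi by (auto intro!: closed_INT convex_INT)
qed

text \<open>The supremum is attained at the proximal point, which is therefore the gradient. Testing
  the supremum at one argument with the maximizer of the other gives both bounds. For the upper one,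
  the strong concavity of the maximized function supplies a negative quadratic term that absorbs the
  change of the maximizer.\<close>

lemma moreau_envelope_between_quadratics:
  fixes g :: "'a::euclidean_space \<Rightarrow> ereal"
  assumes pcc: "proper_closed_convex g" and minor: "\<And>u. ereal (a \<bullet> u + c) \<le> g u" and "0 < l"
  shows "between_quadratics 0 (1 / l)
    (\<lambda>z. real_of_ereal (SUP y. ereal (y \<bullet> z) - g y - ereal (l / 2 * (norm (y - w))\<^sup>2)))
    (\<lambda>z. prox (\<lambda>u. g u / ereal l) (w + (1 / l) *\<^sub>R z))"
proof -
  define P where "P z = prox (\<lambda>u. g u / ereal l) (w + (1 / l) *\<^sub>R z)" for z
  define M where
    "M z = real_of_ereal (SUP y. ereal (y \<bullet> z) - g y - ereal (l / 2 * (norm (y - w))\<^sup>2))" for z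
  define r where "r z = real_of_ereal (g (P z))" for z
  have sub: "has_subgradient g (P z) (z + l *\<^sub>R (w - P z))" for z
  proof -
    have "l *\<^sub>R (w + (1 / l) *\<^sub>R z - P z) = z + l *\<^sub>R (w - P z)"
      using \<open>0 < l\<close> by (simp add: algebra_simps)
    then show ?thesis
      using prox_has_subgradient[OF pcc minor \<open>0 < l\<close> P_def, of z] by simp
  qed
  have r: "g (P z) = ereal (r z)" for z
    using sub[of z] unfolding has_subgradient_def r_def by fastforce
  have lower: "ereal (r z + (z + l *\<^sub>R (w - P z)) \<bullet> (u - P z)) \<le> g u" for z u
    using sub[of z] r[of z] by (auto simp: has_subgradient_def)
  define N where "N z y = y \<bullet> z - l / 2 * (norm (y - w))\<^sup>2" for z y
  \<comment> \<open>Completing the square around \<open>P z\<close>: the subgradient there is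
    exactly the slope that cancels the linear part, leaving only the pure quadratic.\<close>
  have N: "N z y - (r z + (z + l *\<^sub>R (w - P z)) \<bullet> (y - P z))
      = N z (P z) - r z - l / 2 * (norm (y - P z))\<^sup>2" for z y
  proof -
    define e where "e = y - P z"
    define d where "d = P z - w"
    have "(norm (y - w))\<^sup>2 = (norm e)\<^sup>2 + 2 * (d \<bullet> e) + (norm d)\<^sup>2"
      unfolding e_def d_def power2_norm_eq_inner
      by (simp add: inner_diff_left inner_diff_right inner_commute)
    then have "l / 2 * (norm (y - w))\<^sup>2 = l / 2 * (norm e)\<^sup>2 + l * (d \<bullet> e) + l / 2 * (norm d)\<^sup>2"
      by (simp add: distrib_left)
    moreover have "y \<bullet> z = P z \<bullet> z + z \<bullet> e"
      by (simp add: e_def inner_diff_right inner_commute)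
    moreover have "(z + l *\<^sub>R (w - P z)) \<bullet> e = z \<bullet> e - l * (d \<bullet> e)"
      by (simp add: d_def inner_add_left inner_diff_left right_diff_distrib)
    ultimately show ?thesis
      unfolding N_def e_def[symmetric] d_def[symmetric] by linarith
  qed
  have M: "M z = N z (P z) - r z" for z
  proof -
    have "(SUP y. ereal (y \<bullet> z) - g y - ereal (l / 2 * (norm (y - w))\<^sup>2)) = ereal (N z (P z) - r z)"
    proof (rule antisym)
      show "(SUP y. ereal (y \<bullet> z) - g y - ereal (l / 2 * (norm (y - w))\<^sup>2))
          \<le> ereal (N z (P z) - r z)"
      proof (rule SUP_least)
        fix y
        have "0 \<le> l / 2 * (norm (y - P z))\<^sup>2" using \<open>0 < l\<close> by simp
        then show "ereal (y \<bullet> z) - g y - ereal (l / 2 * (norm (y - w))\<^sup>2) \<le> ereal (N z (P z) - r z)"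
          using lower[of z y] N[of z y] by (cases "g y") (auto simp: N_def)
      qed
      show "ereal (N z (P z) - r z)
          \<le> (SUP y. ereal (y \<bullet> z) - g y - ereal (l / 2 * (norm (y - w))\<^sup>2))"
        by (rule SUP_upper2[of "P z"]) (auto simp: r N_def)
    qed
    then show ?thesis by (simp add: M_def)
  qed
  have "between_quadratics 0 (1 / l) M P"
    unfolding between_quadratics_def
  proof (intro allI conjI)
    fix z z'
    have dual: "N z (P z') - r z' \<le> M z - l / 2 * (norm (P z' - P z))\<^sup>2" for z z'
      using lower[of z "P z'"] N[of z "P z'"] by (simp add: r M)
    have shift: "N z y = N z' y + y \<bullet> (z - z')" for y z z'
      by (simp add: N_def inner_diff_right)
    have "0 \<le> l / 2 * (norm (P z - P z'))\<^sup>2" using \<open>0 < l\<close> by simp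
    with dual[of z' z] shift[of z' "P z" z]
    show "M z + P z \<bullet> (z' - z) + 0 / 2 * (norm (z' - z))\<^sup>2 \<le> M z'"
      using M[of z] by simp
    \<comment> \<open>Young's inequality; the weight l matches the quadratic loss in
      \<open>dual\<close>.\<close>
    have "2 * ((P z' - P z) \<bullet> (z' - z)) \<le> l * (norm (P z' - P z))\<^sup>2 + (norm (z' - z))\<^sup>2 / l"
    proof -
      have "0 \<le> (norm (l *\<^sub>R (P z' - P z) - (z' - z)))\<^sup>2 / l"
        using \<open>0 < l\<close> by simp
      also have "\<dots> = l * (norm (P z' - P z))\<^sup>2 - 2 * ((P z' - P z) \<bullet> (z' - z))
          + (norm (z' - z))\<^sup>2 / l"
        using \<open>0 < l\<close> norm_diff_scaleR_sq[of "l *\<^sub>R (P z' - P z)" 1 "z' - z"]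
        by (simp add: power_mult_distrib inner_commute diff_divide_distrib add_divide_distrib
            power2_eq_square)
      finally show ?thesis by simp
    qed
    with dual[of z z'] shift[of z' "P z'" z]
    show "M z' \<le> M z + P z \<bullet> (z' - z) + 1 / l / 2 * (norm (z' - z))\<^sup>2"
      using M[of z'] unfolding inner_diff_left by simp
  qed
  then show ?thesis unfolding P_def[abs_def] M_def[abs_def] .
qed

subsection \<open>Singular values\<close>

lemma transpose_inner:
  fixes A :: "real^'n^'m"
  shows "(transpose A *v u) \<bullet> x = u \<bullet> (A *v x)"
  by (simp add: transpose_matrix_vector dot_lmul_matrix)

text \<open>As a simp rule it rewrites \<open>transpose A *v u\<close> to \<open>u v* A\<close>, and
  then \<open>transpose_inner\<close> no longer matches.\<close>

declare transpose_matrix_vector [simp del]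

lemma norm_matrix_vector_le: "norm (A *v x) \<le> spectral_norm A * norm x"
  for A :: "real^'n^'m"
  unfolding spectral_norm_def by (rule onorm) (rule matrix_vector_mul_bounded_linear)

lemma spectral_norm_nonneg: "0 \<le> spectral_norm A" for A :: "real^'n^'m"
  unfolding spectral_norm_def by (rule onorm_pos_le) (rule matrix_vector_mul_bounded_linear)

lemma norm_transpose_vector_le: "norm (transpose A *v u) \<le> spectral_norm A * norm u"
  for A :: "real^'n^'m"
proof -
  have "norm (transpose A *v u) * norm (transpose A *v u) = u \<bullet> (A *v (transpose A *v u))"
    by (simp flip: transpose_inner power2_eq_square power2_norm_eq_inner)
  also have "\<dots> \<le> norm u * (spectral_norm A * norm (transpose A *v u))"
    by (rule order_trans[OF norm_cauchy_schwarz mult_left_mono[OF norm_matrix_vector_le]]) simp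
  finally have *: "norm (transpose A *v u) * norm (transpose A *v u)
      \<le> (spectral_norm A * norm u) * norm (transpose A *v u)"
    by (simp add: mult_ac)
  show ?thesis
  proof (cases "norm (transpose A *v u) = 0")
    case True
    then show ?thesis by (simp add: spectral_norm_nonneg)
  next
    case False
    with * show ?thesis by (simp add: mult_le_cancel_right)
  qed
qed

lemma full_row_rank_transpose_injective:
  fixes A :: "real^'n^'m"
  assumes "rank A = CARD('m)" "transpose A *v u = 0"
  shows "u = 0"
proof -
  have "inj ((*v) (transpose A))"
    using assms(1) by (simp add: rank_transpose flip: full_rank_injective)
  then show ?thesis using assms(2) by (metis injD matrix_vector_mult_0_right)
qed

text \<open>A minimizer of the norm of \<open>transpose A *v u\<close> on the unit sphere is an
  eigenvector of \<open>A ** transpose A\<close>, so the minimum is itself a singular value and the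
  infimum in the definition is attained. Full row rank makes it positive.\<close>

lemma min_singular_value:
  fixes A :: "real^'n^'m"
  assumes rank: "rank A = CARD('m)"
  shows "0 < min_singular_value A" "min_singular_value A * norm u \<le> norm (transpose A *v u)"
proof -
  have "compact (sphere (0 :: real^'m) 1)" "sphere (0 :: real^'m) 1 \<noteq> {}" by auto
  moreover have "continuous_on (sphere 0 1) (\<lambda>u. norm (transpose A *v u))"
    by (intro continuous_intros)
  ultimately obtain u0 where u0: "u0 \<in> sphere 0 1"
    and min: "\<And>u. u \<in> sphere 0 1 \<Longrightarrow> norm (transpose A *v u0) \<le> norm (transpose A *v u)"
    by (metis continuous_attains_inf)
  define m where "m = norm (transpose A *v u0)"
  have [simp]: "norm u0 = 1" and "u0 \<noteq> 0" using u0 by auto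
  have "0 < m"
    using full_row_rank_transpose_injective[OF rank] \<open>u0 \<noteq> 0\<close> by (auto simp: m_def)
  have m: "m * norm u \<le> norm (transpose A *v u)" for u
  proof (cases "u = 0")
    case False
    have "m \<le> norm (transpose A *v ((1 / norm u) *\<^sub>R u))"
      unfolding m_def by (rule min) (use False in simp)
    also have "transpose A *v ((1 / norm u) *\<^sub>R u) = (1 / norm u) *\<^sub>R (transpose A *v u)"
      by (rule matrix_vector_mult_scaleR)
    finally show ?thesis using False by (simp add: field_simps)
  qed simp
  have "(A ** transpose A) *v u0 = m\<^sup>2 *\<^sub>R u0"
  proof -
    define w where "w = (A ** transpose A) *v u0 - m\<^sup>2 *\<^sub>R u0"
    have first_order: "0 \<le> 2 * (w \<bullet> v)" for v
    proof (rule linear_coeff_nonneg)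
      fix s :: real
      have "(m * norm (u0 + s *\<^sub>R v))\<^sup>2 \<le> (norm (transpose A *v (u0 + s *\<^sub>R v)))\<^sup>2"
        using m[of "u0 + s *\<^sub>R v"] \<open>0 < m\<close> by (intro power_mono) auto
      moreover have "(norm (u0 + s *\<^sub>R v))\<^sup>2 = 1 + 2 * s * (u0 \<bullet> v) + s\<^sup>2 * (norm v)\<^sup>2"
        using norm_diff_scaleR_sq[of u0 "- s" v] by (simp add: inner_commute)
      moreover have "(norm (transpose A *v (u0 + s *\<^sub>R v)))\<^sup>2
          = m\<^sup>2 + 2 * s * (((A ** transpose A) *v u0) \<bullet> v) + s\<^sup>2 * (norm (transpose A *v v))\<^sup>2"
      proof -
        have "transpose A *v (u0 + s *\<^sub>R v) = transpose A *v u0 - (- s) *\<^sub>R (transpose A *v v)"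
          by (simp add: matrix_vector_right_distrib matrix_vector_mult_scaleR)
        moreover have "((A ** transpose A) *v u0) \<bullet> v = (transpose A *v v) \<bullet> (transpose A *v u0)"
          by (metis inner_commute matrix_vector_mul_assoc transpose_inner)
        ultimately show ?thesis
          using norm_diff_scaleR_sq[of "transpose A *v u0" "- s" "transpose A *v v"]
          by (simp add: m_def)
      qed
      ultimately show "0 \<le> s * (2 * (w \<bullet> v))
          + s\<^sup>2 * ((norm (transpose A *v v))\<^sup>2 - m\<^sup>2 * (norm v)\<^sup>2)"
        by (simp add: w_def inner_diff_left power_mult_distrib algebra_simps)
    qed
    \<comment> \<open>\<open>w\<close> is the residual of the eigenvector equation; the direction
      \<open>- w\<close> forces it to vanish.\<close>
    from first_order[of "- w"] have "w = 0" by (simp flip: power2_norm_eq_inner)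
    then show ?thesis by (simp add: w_def)
  qed
  then have "m \<in> singular_values A"
    using \<open>0 < m\<close> \<open>u0 \<noteq> 0\<close> by (auto simp: singular_values_def)
  moreover have "m \<le> s" if "s \<in> singular_values A" for s
  proof -
    from that obtain u where s: "0 \<le> s" and u: "u \<noteq> 0" "(A ** transpose A) *v u = s\<^sup>2 *\<^sub>R u"
      by (auto simp: singular_values_def)
    have "(norm (transpose A *v u))\<^sup>2 = u \<bullet> ((A ** transpose A) *v u)"
      by (simp add: power2_norm_eq_inner transpose_inner flip: matrix_vector_mul_assoc)
    also have "\<dots> = (s * norm u)\<^sup>2" by (simp add: u(2) power_mult_distrib power2_norm_eq_inner)
    finally have "norm (transpose A *v u) = s * norm u" using s by simp
    with m[of u] u(1) show "m \<le> s" by simp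
  qed
  ultimately have "min_singular_value A = m"
    unfolding min_singular_value_def by (intro cInf_eq_minimum)
  with \<open>0 < m\<close> m show "0 < min_singular_value A"
    "min_singular_value A * norm u \<le> norm (transpose A *v u)" by simp_all
qed

lemma min_singular_value_le_spectral_norm:
  fixes A :: "real^'n^'m"
  assumes "rank A = CARD('m)"
  shows "min_singular_value A \<le> spectral_norm A"
proof -
  obtain u :: "real^'m" where u: "norm u = 1" using vector_choose_size[of 1] by auto
  have "min_singular_value A * norm u \<le> spectral_norm A * norm u"
    using min_singular_value(2)[OF assms] norm_transpose_vector_le by (rule order_trans)
  with u show ?thesis by simp
qed

lemma full_row_rank_surj:
  fixes A :: "real^'n^'m"
  assumes "rank A = CARD('m)"
  obtains x where "A *v x = z"
  using assms by (metis full_rank_surjective surjD)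

subsection \<open>Lagrange multipliers\<close>

text \<open>The subgradient inequality at \<open>z\<close> says that \<open>z\<close> attains the
  supremum defining the conjugate at \<nu>; keeping only \<open>z\<close> in the supremum at other
  points gives the affine minorant.\<close>

lemma conjugate_has_subgradient:
  assumes "has_subgradient h z \<nu>"
  shows "has_subgradient (conjugate h) \<nu> z"
proof -
  obtain r where r: "h z = ereal r" and sub: "\<And>w. ereal (r + \<nu> \<bullet> (w - z)) \<le> h w"
    using assms by (auto simp: has_subgradient_def)
  have "conjugate h \<nu> = ereal (z \<bullet> \<nu> - r)"
  proof (rule antisym)
    show "conjugate h \<nu> \<le> ereal (z \<bullet> \<nu> - r)"
      unfolding conjugate_def
    proof (rule SUP_least)
      fix w
      show "ereal (w \<bullet> \<nu>) - h w \<le> ereal (z \<bullet> \<nu> - r)"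
        using sub[of w] by (cases "h w") (auto simp: inner_diff_right inner_commute)
    qed
    show "ereal (z \<bullet> \<nu> - r) \<le> conjugate h \<nu>"
      unfolding conjugate_def by (rule SUP_upper2[of z]) (auto simp: r)
  qed
  moreover have "ereal (z \<bullet> \<nu> - r + z \<bullet> (y - \<nu>)) \<le> conjugate h y" for y
    unfolding conjugate_def by (rule SUP_upper2[of z]) (auto simp: r inner_diff_right)
  ultimately show ?thesis unfolding has_subgradient_def by blast
qed

text \<open>
  Surjectivity of \<open>A\<close> replaces the usual constraint qualification: minimality along the kernel
  of \<open>A\<close> puts the gradient into the range of the transpose.
\<close>

lemma lagrange_multiplier_exists:
  fixes A :: "real^'n^'m"
  assumes rank: "rank A = CARD('m)" and pcc: "proper_closed_convex h"
    and der: "GDERIV f xs :> d"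
    and min: "\<And>x. objective f h A b xs \<le> objective f h A b x"
  shows "\<exists>\<nu>. d + transpose A *v \<nu> = 0 \<and> has_subgradient h (A *v xs - b) \<nu>"
proof -
  define z where "z = A *v xs - b"
  have ninf: "h w \<noteq> -\<infinity>" for w using pcc by (simp add: proper_closed_convex_def)
  obtain z1 where z1: "h z1 \<noteq> \<infinity>" using pcc by (auto simp: proper_closed_convex_def)
  \<comment> \<open>Some point has a finite objective by surjectivity of \<open>A\<close>, hence so
    has the minimizer.\<close>
  obtain x1 where "A *v x1 = z1 + b" using full_row_rank_surj[OF rank] by blast
  with min[of x1] z1 ninf[of z] ninf[of z1] have "h z \<noteq> \<infinity>"
    by (cases "h z1") (auto simp: objective_def z_def)
  with ninf obtain r where r: "h z = ereal r" by (cases "h z") auto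
  \<comment> \<open>If the slope of \<open>f\<close> along \<open>e\<close> plus the increment of
    \<open>h\<close> were negative, a short step along \<open>e\<close> would lower the objective,
    since \<open>h\<close> lies below its chord.\<close>
  have directional: "0 \<le> d \<bullet> e + (t - r)" if e: "A *v e = w - z" and t: "h w = ereal t" for e w t
  proof (rule ccontr)
    assume neg: "\<not> 0 \<le> d \<bullet> e + (t - r)"
    have "((\<lambda>s. f (xs + s *\<^sub>R e)) has_real_derivative d \<bullet> e) (at 0)"
      by (rule gderiv_along_line) (simp add: der)
    then have "((\<lambda>s. f (xs + s *\<^sub>R e) + s * (t - r)) has_real_derivative d \<bullet> e + (t - r)) (at 0)"
      by (auto intro!: derivative_eq_intros)
    from DERIV_neg_dec_right[OF this] neg obtain \<delta> where \<delta>: "0 < \<delta>"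
      and dec: "\<And>s. 0 < s \<Longrightarrow> s < \<delta> \<Longrightarrow> f (xs + s *\<^sub>R e) + s * (t - r) < f xs"
      by auto
    define s where "s = min (\<delta> / 2) 1"
    have s: "0 < s" "s < \<delta>" "s \<le> 1" using \<delta> by (auto simp: s_def)
    have "(z, r) \<in> ereal_epigraph h" "(w, t) \<in> ereal_epigraph h"
      by (auto simp: ereal_epigraph_def r t)
    moreover have "convex (ereal_epigraph h)" using pcc by (simp add: proper_closed_convex_def)
    ultimately have "(1 - s) *\<^sub>R (z, r) + s *\<^sub>R (w, t) \<in> ereal_epigraph h"
      using s by (intro convexD_alt) auto
    moreover have "(1 - s) *\<^sub>R z + s *\<^sub>R w = A *v (xs + s *\<^sub>R e) - b"
    proof -
      have "w = z + A *v e" using e by simp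
      then have "(1 - s) *\<^sub>R z + s *\<^sub>R w = z + s *\<^sub>R (A *v e)"
        by (simp add: algebra_simps)
      then show ?thesis
        by (simp add: matrix_vector_right_distrib matrix_vector_mult_scaleR z_def)
    qed
    ultimately have "h (A *v (xs + s *\<^sub>R e) - b) \<le> ereal ((1 - s) * r + s * t)"
      by (simp add: ereal_epigraph_def)
    then have "objective f h A b (xs + s *\<^sub>R e)
        \<le> ereal (f (xs + s *\<^sub>R e)) + ereal ((1 - s) * r + s * t)"
      unfolding objective_def by (rule add_left_mono)
    from order_trans[OF min this] have "ereal (f xs + r) \<le> ereal (f (xs + s *\<^sub>R e) + ((1 - s) * r + s * t))"
      by (simp add: objective_def z_def[symmetric] r)
    with dec[OF s(1,2)] show False by (simp add: algebra_simps)
  qed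
  \<comment> \<open>Invertibility of \<open>A ** transpose A\<close> yields the least squares
    multiplier: with it, \<open>w\<close> below is the projection of \<open>d\<close> onto the
    kernel of \<open>A\<close>.\<close>
  have "inj ((*v) (A ** transpose A))"
  proof (rule injI)
    fix u v assume "(A ** transpose A) *v u = (A ** transpose A) *v v"
    then have "(A ** transpose A) *v (u - v) = 0" by (simp add: matrix_vector_mult_diff_distrib)
    then have "(transpose A *v (u - v)) \<bullet> (transpose A *v (u - v)) = 0"
      by (simp add: transpose_inner flip: matrix_vector_mul_assoc)
    then show "u = v"
      using full_row_rank_transpose_injective[OF rank, of "u - v"] by simp
  qed
  then have "surj ((*v) (A ** transpose A))"
    by (intro linear_injective_imp_surjective) auto
  then obtain \<nu> where \<nu>: "(A ** transpose A) *v \<nu> = - (A *v d)" by (metis surjD)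
  define w where "w = d + transpose A *v \<nu>"
  have ker: "A *v w = 0"
    using \<nu> by (simp add: w_def matrix_vector_right_distrib matrix_vector_mul_assoc)
  moreover have "A *v (- w) = 0"
    using ker by (metis matrix_vector_mult_diff_distrib matrix_vector_mult_0_right diff_0 neg_0_equal_iff_equal)
  \<comment> \<open>Moving along the kernel leaves the argument of \<open>h\<close> unchanged, so
    both signs of \<open>w\<close> are admissible directions with zero increment.\<close>
  ultimately have "d \<bullet> w = 0"
    using directional[of w z r] directional[of "- w" z r] r by simp
  moreover have "(transpose A *v \<nu>) \<bullet> w = 0" by (simp add: transpose_inner ker)
  ultimately have "w \<bullet> w = 0" by (simp add: w_def inner_add_left)
  then have "w = 0" by simp
  moreover have "ereal (r + \<nu> \<bullet> (y - z)) \<le> h y" for y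
  proof (cases "h y")
    case (real t)
    obtain e where e: "A *v e = y - z" using full_row_rank_surj[OF rank] by blast
    have "d \<bullet> e = - (transpose A *v \<nu>) \<bullet> e"
      using \<open>w = 0\<close> by (metis add_eq_0_iff2 w_def)
    then have "d \<bullet> e = - (\<nu> \<bullet> (y - z))"
      by (simp add: transpose_inner e)
    with directional[OF e real] show ?thesis by (simp add: real)
  qed (use ninf in auto)
  ultimately show ?thesis
    using r unfolding has_subgradient_def w_def z_def by blast
qed

subsection \<open>The inexact proximal point method\<close>

lemma between_quadratics_affine:
  fixes A :: "real^'n^'m"
  assumes bq: "between_quadratics 0 K M P" and "0 \<le> K"
  shows "between_quadratics 0 (K * (spectral_norm A)\<^sup>2) (\<lambda>x. M (A *v x - b))
    (\<lambda>x. transpose A *v P (A *v x - b))"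
  unfolding between_quadratics_def
proof (intro allI conjI)
  fix x y
  have diff: "(A *v y - b) - (A *v x - b) = A *v (y - x)"
    by (simp add: matrix_vector_mult_diff_distrib)
  show "M (A *v x - b) + (transpose A *v P (A *v x - b)) \<bullet> (y - x) + 0 / 2 * (norm (y - x))\<^sup>2
      \<le> M (A *v y - b)"
    using between_quadratics_lower[OF bq, of "A *v x - b" "A *v y - b"]
    by (simp only: diff transpose_inner)
  have "(norm (A *v (y - x)))\<^sup>2 \<le> (spectral_norm A * norm (y - x))\<^sup>2"
    by (intro power_mono norm_matrix_vector_le) simp
  then have "K / 2 * (norm (A *v (y - x)))\<^sup>2 \<le> K / 2 * (spectral_norm A * norm (y - x))\<^sup>2"
    using \<open>0 \<le> K\<close> by (intro mult_left_mono) auto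
  then show "M (A *v y - b) \<le> M (A *v x - b) + (transpose A *v P (A *v x - b)) \<bullet> (y - x)
      + K * (spectral_norm A)\<^sup>2 / 2 * (norm (y - x))\<^sup>2"
    using between_quadratics_upper[OF bq, of "A *v y - b" "A *v x - b"]
    by (simp only: diff transpose_inner) (simp add: power_mult_distrib mult_ac)
qed

text \<open>The affine minorant given by \<open>a\<close> and \<open>c\<close> makes the proximal
  problems of the conjugate solvable. The theorem takes it from a multiplier of the original
  problem.\<close>

locale composite_problem =
  fixes \<phi> :: "real^'n \<Rightarrow> real" and G :: "real^'n \<Rightarrow> real^'n"
    and h :: "real^'m \<Rightarrow> ereal" and A :: "real^'n^'m" and b :: "real^'m" and \<mu> L :: real
    and a :: "real^'m" and c :: real
  assumes bq: "between_quadratics \<mu> L \<phi> G" and \<mu>: "0 < \<mu>" "\<mu> \<le> L"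
    and rank: "rank A = CARD('m)"
    and pcc: "proper_closed_convex (conjugate h)"
    and minor: "\<And>u. ereal (a \<bullet> u + c) \<le> conjugate h u"
begin

text \<open>The smallest value that the algorithm admits. The rate
  \<open>mu_Phi A L / (12 * l)\<close> becomes 1/12, and the smoothness constant of
  \<open>Psi\<close> becomes L (1 + \<kappa>^2) with \<kappa> the condition number.\<close>

definition "l = mu_Phi A L"

definition "dual_update p x = prox (\<lambda>u. conjugate h u / ereal l) (p + (1 / l) *\<^sub>R (A *v x - b))"

text \<open>The optimality conditions of one exact proximal step from \<open>p\<close>. For
  \<open>p = lam\<close> the proximal term vanishes and they become those of the problem
  itself.\<close>

definition "ppa_saddle p x lam \<longleftrightarrow>
  G x + transpose A *v lam = 0 \<and> has_subgradient (conjugate h) lam (A *v x - b + l *\<^sub>R (p - lam))"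

lemma L_pos: "0 < L" using \<mu> by simp

lemma l_eq: "l = (min_singular_value A)\<^sup>2 / L"
  by (simp add: l_def mu_Phi_def)

lemma l_pos: "0 < l"
  using min_singular_value(1)[OF rank] L_pos by (simp add: l_eq)

lemma spectral_norm_pos: "0 < spectral_norm A"
  using min_singular_value(1)[OF rank] min_singular_value_le_spectral_norm[OF rank] by simp

lemma Psi_between_quadratics:
  "between_quadratics \<mu> (L + (spectral_norm A)\<^sup>2 / l) (Psi \<phi> h A b l p)
    (\<lambda>x. G x + transpose A *v dual_update p x)"
proof -
  have "0 \<le> 1 / l" using l_pos by simp
  from between_quadratics_add[OF bq
      between_quadratics_affine[OF moreau_envelope_between_quadratics[OF pcc minor l_pos, of p] this,
        of A b]]
  show ?thesis
    unfolding Psi_def[abs_def] dual_update_def by simp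
qed

lemma dual_update_has_subgradient:
  "has_subgradient (conjugate h) (dual_update p x) (A *v x - b + l *\<^sub>R (p - dual_update p x))"
proof -
  have "l *\<^sub>R (p + (1 / l) *\<^sub>R (A *v x - b) - dual_update p x)
      = A *v x - b + l *\<^sub>R (p - dual_update p x)"
    using l_pos by (simp add: scaleR_add_right scaleR_diff_right)
  then show ?thesis
    using prox_has_subgradient[OF pcc minor l_pos dual_update_def, of p x] by simp
qed

text \<open>This converts the primal error of an inner loop into a dual error; the factor is the
  unit in which \<open>inexact_ppa_run\<close> measures dual errors.\<close>

lemma dual_update_lipschitz:
  "norm (dual_update p x - dual_update p y) \<le> spectral_norm A / l * norm (x - y)"
proof -
  define u where "u = dual_update p x - dual_update p y"
  have "0 \<le> (A *v (x - y) - l *\<^sub>R u) \<bullet> u"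
    using has_subgradient_monotone[OF dual_update_has_subgradient[of p x]
        dual_update_has_subgradient[of p y]]
    by (simp add: u_def matrix_vector_mult_diff_distrib algebra_simps)
  then have "l * (norm u * norm u) \<le> (A *v (x - y)) \<bullet> u"
    by (simp add: inner_diff_left power2_norm_eq_inner flip: power2_eq_square)
  also have "\<dots> \<le> spectral_norm A * norm (x - y) * norm u"
    by (rule order_trans[OF norm_cauchy_schwarz mult_right_mono[OF norm_matrix_vector_le]]) simp
  finally have "(l * norm u) * norm u \<le> (spectral_norm A * norm (x - y)) * norm u"
    by (simp add: mult.assoc)
  then have "l * norm u \<le> spectral_norm A * norm (x - y)"
    using spectral_norm_nonneg[of A] by (cases "norm u = 0") (auto simp: mult_le_cancel_right)
  then show ?thesis using l_pos by (simp add: u_def field_simps)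
qed

section \<open>Exact proximal steps\<close>

lemma ppa_saddle_exists: "\<exists>x. ppa_saddle p x (dual_update p x)"
proof -
  have "\<mu> \<le> L + (spectral_norm A)\<^sup>2 / l" using \<mu> l_pos by (simp add: add_increasing2)
  from between_quadratics_zero_exists[OF Psi_between_quadratics \<mu>(1) this]
  show ?thesis
    using dual_update_has_subgradient by (simp add: ppa_saddle_def)
qed

lemma ppa_saddle_grad_diff:
  assumes "ppa_saddle p x lam" "ppa_saddle p' x' lam'"
  shows "G x - G x' = - (transpose A *v (lam - lam'))"
proof -
  have "G x = - (transpose A *v lam)" "G x' = - (transpose A *v lam')"
    using assms by (auto simp: ppa_saddle_def eq_neg_iff_add_eq_0)
  then show ?thesis by (simp add: matrix_vector_mult_diff_distrib)
qed

text \<open>Monotonicity of the subgradients yields l |u|^2 from the proximal term. Cocoercivity of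
  \<open>G\<close> with the least singular value yields a second l |u|^2, since l is the square of
  that value over L. Together they give the factor 1/2.\<close>

lemma ppa_saddle_contraction:
  assumes "ppa_saddle p x lam" "ppa_saddle p' x' lam'"
  shows "norm (lam - lam') \<le> norm (p - p') / 2"
proof -
  define u where "u = lam - lam'"
  have grad: "G x - G x' = - (transpose A *v u)"
    unfolding u_def by (rule ppa_saddle_grad_diff[OF assms])
  have "0 \<le> (A *v (x - x') + l *\<^sub>R (p - p') - l *\<^sub>R u) \<bullet> u"
    using has_subgradient_monotone[of "conjugate h" lam "A *v x - b + l *\<^sub>R (p - lam)"
        lam' "A *v x' - b + l *\<^sub>R (p' - lam')"] assms
    by (simp add: ppa_saddle_def u_def matrix_vector_mult_diff_distrib algebra_simps)
  then have 1: "l * (norm u)\<^sup>2 \<le> (A *v (x - x')) \<bullet> u + l * ((p - p') \<bullet> u)"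
    by (simp add: inner_diff_left inner_add_left power2_norm_eq_inner)
  have "(norm (transpose A *v u))\<^sup>2 \<le> L * ((G x - G x') \<bullet> (x - x'))"
    using between_quadratics_cocoercive[OF bq _ L_pos, of x x'] \<mu> by (simp add: grad)
  also have "\<dots> = - L * ((A *v (x - x')) \<bullet> u)"
    by (simp add: grad transpose_inner inner_commute[of u])
  finally have "(norm (transpose A *v u))\<^sup>2 / L \<le> - ((A *v (x - x')) \<bullet> u)"
    using L_pos by (simp add: field_simps)
  moreover have "l * (norm u)\<^sup>2 \<le> (norm (transpose A *v u))\<^sup>2 / L"
  proof -
    have "(min_singular_value A * norm u)\<^sup>2 \<le> (norm (transpose A *v u))\<^sup>2"
      using min_singular_value[OF rank] by (intro power_mono) auto
    then show ?thesis
      using L_pos by (simp add: l_eq power_mult_distrib divide_right_mono)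
  qed
  ultimately have "2 * (l * (norm u)\<^sup>2) \<le> l * ((p - p') \<bullet> u)"
    using 1 by linarith
  also have "\<dots> \<le> l * (norm (p - p') * norm u)"
    using l_pos by (intro mult_left_mono norm_cauchy_schwarz) simp
  finally have "l * norm u * (2 * norm u) \<le> l * norm u * norm (p - p')"
    by (simp add: power2_eq_square mult_ac)
  then have "2 * norm u \<le> norm (p - p')"
    using l_pos by (cases "norm u = 0") (auto simp: mult_le_cancel_left)
  then show ?thesis by (simp add: u_def)
qed

lemma ppa_saddle_primal_le:
  assumes "ppa_saddle p x lam" "ppa_saddle p' x' lam'"
  shows "norm (x - x') \<le> spectral_norm A / \<mu> * norm (lam - lam')"
proof -
  have "\<mu> * norm (x - x') \<le> spectral_norm A * norm (lam - lam')"
    using ppa_saddle_grad_diff[OF assms] between_quadratics_expansive[OF bq, of x x']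
      norm_transpose_vector_le[of A "lam - lam'"] by simp
  then show ?thesis using \<mu> by (simp add: field_simps)
qed

lemma saddle_point_exists: "\<exists>x lam. ppa_saddle lam x lam"
proof -
  obtain X where X: "\<And>p. ppa_saddle p (X p) (dual_update p (X p))"
    using ppa_saddle_exists by metis
  have "\<exists>!p. dual_update p (X p) = p"
  proof (rule banach_fix_type[of "1 / 2"])
    show "\<forall>p p'. dist (dual_update p (X p)) (dual_update p' (X p')) \<le> 1 / 2 * dist p p'"
      using ppa_saddle_contraction[OF X X] by (simp add: dist_norm)
  qed auto
  with X show ?thesis by metis
qed

section \<open>Geometric decay of the tolerances\<close>

lemma ppa_tolerance_pos: "0 < R \<Longrightarrow> 0 < ppa_tolerance A L l R k"
  using l_pos by (simp add: ppa_tolerance_def flip: l_def)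

lemma ppa_tolerance_0: "ppa_tolerance A L l R 0 = R"
  using l_pos by (simp add: ppa_tolerance_def flip: l_def)

text \<open>Consecutive tolerances have ratio sqrt (11/12), which is at least 3/4. Since 4/3 is less
  than 2, halving the dual error leaves room for the inexactness of the inner loop.\<close>

lemma ppa_tolerance_Suc:
  assumes "0 < R"
  shows "ppa_tolerance A L l R k \<le> 4 / 3 * ppa_tolerance A L l R (Suc k)"
proof -
  define t where "t = (11 / 12 :: real) powr (real k / 2)"
  have tol: "ppa_tolerance A L l R k = t * R"
    using l_pos by (simp add: ppa_tolerance_def t_def flip: l_def)
  have "ppa_tolerance A L l R (Suc k) = (11 / 12) powr (real k / 2 + 1 / 2) * R"
    using l_pos by (simp add: ppa_tolerance_def add_divide_distrib add.commute flip: l_def)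
  also have "\<dots> = t * sqrt (11 / 12) * R"
    by (simp add: t_def powr_add powr_half_sqrt)
  finally have Suc: "ppa_tolerance A L l R (Suc k) = t * R * sqrt (11 / 12)" by simp
  have "3 / 4 \<le> sqrt (11 / 12)" by (rule real_le_rsqrt) (simp add: power2_eq_square)
  then have "t * R * (3 / 4) \<le> t * R * sqrt (11 / 12)"
    using assms by (intro mult_left_mono) (auto simp: t_def)
  then show ?thesis by (simp add: tol Suc)
qed

lemma ppa_tolerance_le_exp:
  assumes "0 < R"
  shows "ppa_tolerance A L l R k \<le> exp (- (real k / 24)) * R"
proof -
  have "ln (11 / 12 :: real) \<le> - (1 / 12)"
    using ln_le_minus_one[of "11 / 12"] by simp
  then have "real k / 2 * ln (11 / 12) \<le> real k / 2 * - (1 / 12)"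
    by (intro mult_left_mono) auto
  then have "(11 / 12) powr (real k / 2) \<le> exp (- (real k / 24))"
    by (simp add: powr_def)
  then show ?thesis
    using assms l_pos by (simp add: ppa_tolerance_def flip: l_def)
qed

text \<open>Let \<delta> be the next tolerance, s = |A| / l and C = |A| s / \<mu>. A dual error of 3
  s times the old tolerance is at most 4 s \<delta>; the exact step halves it to 2 s \<delta>, and
  the inner error adds s \<delta>, which restores the 3. The exact primal point is within 2 C
  \<delta> of \<open>xs\<close> and the inner error adds \<delta> <= C \<delta>, whence B = 3 C. The
  inner loop starts within 4 C \<delta> + 2 C \<delta> <= 3 B \<delta> of its minimizer, a multiple
  of \<delta> that does not depend on k.\<close>

lemma inexact_ppa_run:
  fixes x0 :: "real^'n" and lam0 :: "real^'m"
  defines "K \<equiv> L + (spectral_norm A)\<^sup>2 / l"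
    and "B \<equiv> 3 * ((condition_number A)\<^sup>2 * (L / \<mu>))"
  assumes saddle: "ppa_saddle ls xs ls" and R: "0 < R"
    and x0: "norm (x0 - xs) \<le> B * R"
    and lam0: "norm (lam0 - ls) \<le> 3 * (spectral_norm A / l) * R"
  shows "\<exists>x lam N. inexact_ppa \<phi> h A b L \<mu> l R x0 lam0 k x lam N \<and>
    norm (lam - ls) \<le> 3 * (spectral_norm A / l) * ppa_tolerance A L l R k \<and>
    norm (x - xs) \<le> B * ppa_tolerance A L l R k \<and>
    real N \<le> real k * (2 * (sqrt (K / \<mu>) * ln (2 * (K / \<mu> * (3 * B))\<^sup>2) + 1))"
proof (induction k)
  case 0
  then show ?case
    using x0 lam0 by (auto intro!: exI inexact_ppa.init simp: ppa_tolerance_0)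
next
  case (Suc k)
  define C where "C = (condition_number A)\<^sup>2 * (L / \<mu>)"
  have "1 \<le> condition_number A"
    using min_singular_value(1)[OF rank] min_singular_value_le_spectral_norm[OF rank]
    by (simp add: condition_number_def)
  then have "1 * 1 \<le> C"
    unfolding C_def using \<mu> by (intro mult_mono) auto
  then have C: "1 \<le> C" and BC: "B = 3 * C" by (simp_all add: B_def C_def)
  have snC: "spectral_norm A / \<mu> * (spectral_norm A / l) = C"
    using min_singular_value(1)[OF rank] \<mu>
    by (simp add: C_def l_eq condition_number_def power2_eq_square mult_ac)
  define \<delta> where "\<delta> = ppa_tolerance A L l R (Suc k)"
  define s where "s = spectral_norm A / l"
  have \<delta>: "0 < \<delta>" and \<delta>k: "ppa_tolerance A L l R k \<le> 4 / 3 * \<delta>" and s: "0 < s"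
    using ppa_tolerance_pos[OF R] ppa_tolerance_Suc[OF R] spectral_norm_pos l_pos
    by (auto simp: \<delta>_def s_def)
  obtain x lam N where run: "inexact_ppa \<phi> h A b L \<mu> l R x0 lam0 k x lam N"
    and lam: "norm (lam - ls) \<le> 3 * s * ppa_tolerance A L l R k"
    and x: "norm (x - xs) \<le> B * ppa_tolerance A L l R k"
    and N: "real N \<le> real k * (2 * (sqrt (K / \<mu>) * ln (2 * (K / \<mu> * (3 * B))\<^sup>2) + 1))"
    using Suc.IH unfolding s_def by blast
  obtain x' where x': "ppa_saddle lam x' (dual_update lam x')"
    using ppa_saddle_exists by blast
  have "3 * s * ppa_tolerance A L l R k \<le> 3 * s * (4 / 3 * \<delta>)"
    using \<delta>k s by (intro mult_left_mono) auto
  then have lam': "norm (dual_update lam x' - ls) \<le> 2 * s * \<delta>"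
    using ppa_saddle_contraction[OF x' saddle] lam by (simp add: mult_ac)
  have "norm (x' - xs) \<le> spectral_norm A / \<mu> * (2 * s * \<delta>)"
    using ppa_saddle_primal_le[OF x' saddle] lam' \<mu> spectral_norm_pos
    by (meson divide_nonneg_pos less_imp_le mult_left_mono order_trans)
  also have "\<dots> = 2 * C * \<delta>" by (simp add: s_def flip: snC)
  finally have xx: "norm (x' - xs) \<le> 2 * C * \<delta>" .
  have "B * ppa_tolerance A L l R k \<le> B * (4 / 3 * \<delta>)"
    using \<delta>k C by (intro mult_left_mono) (auto simp: BC)
  with x have "norm (x - xs) \<le> 4 * C * \<delta>" by (simp add: BC)
  with xx have "norm (x - x') \<le> 6 * C * \<delta>"
    using norm_triangle_ineq4[of "x - xs" "x' - xs"] by simp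
  also have "\<dots> \<le> 3 * B * \<delta>" using C \<delta> by (simp add: BC)
  finally have "norm (x - x') \<le> 3 * B * \<delta>" .
  moreover have "G x' + transpose A *v dual_update lam x' = 0"
    using x' by (simp add: ppa_saddle_def)
  moreover have "\<mu> \<le> K" using \<mu> l_pos by (simp add: K_def add_increasing2)
  ultimately obtain n y where agd: "agd_run K \<mu> (Psi \<phi> h A b l lam) x \<delta> n y"
    and n: "real n \<le> sqrt (K / \<mu>) * ln (2 * (K / \<mu> * (3 * B))\<^sup>2) + 1"
    using agd_run_exists[OF Psi_between_quadratics[of lam, folded K_def] \<mu>(1), of x' \<delta> "3 * B" x]
      \<delta> C by (auto simp: BC)
  have "grad (Psi \<phi> h A b l lam) y = G y + transpose A *v dual_update lam y"
    using \<mu> by (intro grad_eq between_quadratics_gderiv[OF Psi_between_quadratics]) simp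
  moreover have "norm (grad (Psi \<phi> h A b l lam) y) \<le> \<mu> * \<delta>"
    using agd unfolding agd_run_def by blast
  ultimately have "norm (G y + transpose A *v dual_update lam y) \<le> \<mu> * \<delta>"
    by simp
  \<comment> \<open>The gradient of \<open>Psi\<close> vanishes at x', so strong convexity turns the
    stopping test into a distance; its factor \<mu> cancels.\<close>
  then have "\<mu> * norm (y - x') \<le> \<mu> * \<delta>"
    using between_quadratics_expansive[OF Psi_between_quadratics, of y x' lam] x'
    by (simp add: ppa_saddle_def)
  then have y: "norm (y - x') \<le> \<delta>" using \<mu> by simp
  have "norm (y - xs) \<le> \<delta> + 2 * C * \<delta>"
    using norm_triangle_ineq[of "y - x'" "x' - xs"] y xx by simp
  also have "\<dots> \<le> B * \<delta>" using C \<delta> by (simp add: BC algebra_simps)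
  finally have "norm (y - xs) \<le> B * \<delta>" .
  moreover have "norm (dual_update lam y - ls) \<le> 3 * s * \<delta>"
  proof -
    have "norm (dual_update lam y - dual_update lam x') \<le> s * \<delta>"
      using dual_update_lipschitz[of lam y x'] mult_left_mono[OF y, of s] s by (simp add: s_def)
    then show ?thesis
      using norm_triangle_ineq[of "dual_update lam y - dual_update lam x'" "dual_update lam x' - ls"]
        lam' by simp
  qed
  moreover have "inexact_ppa \<phi> h A b L \<mu> l R x0 lam0 (Suc k) y (dual_update lam y) (N + 2 * n)"
    using inexact_ppa.step[OF run agd[unfolded K_def \<delta>_def] refl] by (simp add: dual_update_def)
  moreover have "real (N + 2 * n)
      \<le> real (Suc k) * (2 * (sqrt (K / \<mu>) * ln (2 * (K / \<mu> * (3 * B))\<^sup>2) + 1))"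
    using N n by (simp add: algebra_simps)
  ultimately show ?case unfolding s_def \<delta>_def by blast
qed

end

subsection \<open>The regularized problem\<close>

lemma regularized_between_quadratics:
  assumes "between_quadratics 0 K f G"
  shows "between_quadratics (\<epsilon> / D\<^sup>2) (K + \<epsilon> / D\<^sup>2) (regularized f \<epsilon> D x0)
    (\<lambda>x. G x + (\<epsilon> / D\<^sup>2) *\<^sub>R (x - x0))"
proof -
  have "regularized f \<epsilon> D x0 = (\<lambda>x. f x + \<epsilon> / D\<^sup>2 / 2 * (norm (x - x0))\<^sup>2)"
    by (auto simp: regularized_def)
  then show ?thesis
    using between_quadratics_add[OF assms between_quadratics_sq_dist[of "\<epsilon> / D\<^sup>2" x0]] by simp
qed

text \<open>Test the difference of the two optimality conditions with \<open>x - xstar\<close>.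
  Monotonicity removes the contributions of \<open>f\<close> and of the conjugate and leaves an
  obtuse angle at \<open>x\<close>: the point lies in the ball with diameter from \<open>x0\<close>
  to \<open>xstar\<close>.\<close>

lemma regularized_solution_near:
  fixes A :: "real^'n^'m"
  assumes bq: "between_quadratics 0 K f G" and "0 < \<mu>"
    and opt: "G xstar + transpose A *v \<nu> = 0"
      "has_subgradient (conjugate h) \<nu> (A *v xstar - b)"
    and reg: "G x + \<mu> *\<^sub>R (x - x0) + transpose A *v lam = 0"
      "has_subgradient (conjugate h) lam (A *v x - b)"
  shows "norm (x - x0) \<le> norm (x0 - xstar)"
proof -
  have "G x - G xstar + \<mu> *\<^sub>R (x - x0) = - (transpose A *v (lam - \<nu>))"
  proof -
    have "G xstar = - (transpose A *v \<nu>)" "G x + \<mu> *\<^sub>R (x - x0) = - (transpose A *v lam)"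
      using opt(1) reg(1) by (auto simp: eq_neg_iff_add_eq_0)
    then show ?thesis by (simp add: matrix_vector_mult_diff_distrib algebra_simps)
  qed
  then have "(G x - G xstar) \<bullet> (x - xstar) + \<mu> * ((x - x0) \<bullet> (x - xstar))
      = - ((lam - \<nu>) \<bullet> (A *v (x - xstar)))"
    by (metis inner_add_left inner_minus_left inner_scaleR_left transpose_inner)
  moreover have "0 \<le> (lam - \<nu>) \<bullet> (A *v (x - xstar))"
    using has_subgradient_monotone[OF reg(2) opt(2)]
    by (simp add: matrix_vector_mult_diff_distrib inner_commute)
  moreover have "0 \<le> (G x - G xstar) \<bullet> (x - xstar)"
    using between_quadratics_strongly_monotone[OF bq, of x xstar] by simp
  ultimately have "\<mu> * ((x - x0) \<bullet> (x - xstar)) \<le> 0" by linarith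
  then have "(x - x0) \<bullet> (x - xstar) \<le> 0" using \<open>0 < \<mu>\<close> by (simp add: mult_le_0_iff)
  then have "norm (x - x0) * norm (x - x0) \<le> (x - x0) \<bullet> (xstar - x0)"
    by (simp add: inner_diff_right power2_norm_eq_inner flip: power2_eq_square)
  also have "\<dots> \<le> norm (x0 - xstar) * norm (x - x0)"
    using norm_cauchy_schwarz[of "x - x0" "xstar - x0"] by (simp add: norm_minus_commute mult.commute)
  finally show ?thesis
    by (cases "norm (x - x0) = 0") (auto simp: mult_le_cancel_right)
qed

lemma subopt_le:
  fixes A :: "real^'n^'m"
  assumes bq: "between_quadratics 0 L (regularized f \<epsilon> D x0) G"
    and sub: "has_subgradient (conjugate h) lam (A *v xs - b)"
    and stat: "G xs + transpose A *v lam = 0"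
    and min: "\<And>y. objective f h A b xstar \<le> objective f h A b y"
    and fin: "h (A *v xstar - b) = ereal r"
    and D: "0 < D" "norm (x0 - xstar) \<le> D" and "0 \<le> \<epsilon>" "0 \<le> \<rho>"
  shows "subopt \<rho> f h A b x \<le> ereal ((norm (G xs) + \<rho> * spectral_norm A) * norm (x - xs)
    + L / 2 * (norm (x - xs))\<^sup>2 + \<epsilon> / 2)"
proof -
  let ?\<phi> = "regularized f \<epsilon> D x0"
  define z where "z = A *v xs - b"
  obtain t where t: "conjugate h lam = ereal t"
    and lower: "\<And>y. ereal (t + z \<bullet> (y - lam)) \<le> conjugate h y"
    using sub by (auto simp: has_subgradient_def z_def)
  have trunc: "h_trunc \<rho> h (A *v x - b) \<le> ereal (\<rho> * spectral_norm A * norm (x - xs) + lam \<bullet> z - t)"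
    unfolding h_trunc_def
  proof (rule SUP_least)
    fix y :: "real^'m" assume "y \<in> cball 0 \<rho>"
    then have y: "norm y \<le> \<rho>" by simp
    have "(A *v (x - xs)) \<bullet> y \<le> (spectral_norm A * norm (x - xs)) * \<rho>"
      using norm_cauchy_schwarz[of "A *v (x - xs)" y]
        mult_mono[OF norm_matrix_vector_le[of A "x - xs"] y] spectral_norm_nonneg[of A]
      by simp
    moreover have "A *v (x - xs) = (A *v x - b) - z"
      by (simp add: z_def matrix_vector_mult_diff_distrib)
    ultimately have "(A *v x - b) \<bullet> y - z \<bullet> y \<le> \<rho> * spectral_norm A * norm (x - xs)"
      by (simp add: inner_diff_left mult_ac)
    \<comment> \<open>After inserting the affine minorant with slope \<open>z\<close>, only the
      displacement \<open>A *v (x - xs)\<close> is still paired with \<open>y\<close>, and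
      \<open>y\<close> has norm at most \<rho>.\<close>
    with lower[of y]
    show "ereal ((A *v x - b) \<bullet> y) - conjugate h y
        \<le> ereal (\<rho> * spectral_norm A * norm (x - xs) + lam \<bullet> z - t)"
      by (cases "conjugate h y") (auto simp: inner_diff_right inner_commute)
  qed
  have "0 \<le> \<epsilon> / (2 * D\<^sup>2) * (norm (x - x0))\<^sup>2" using \<open>0 \<le> \<epsilon>\<close> by simp
  then have fx: "f x \<le> ?\<phi> x" unfolding regularized_def by linarith
  have "?\<phi> x \<le> ?\<phi> xs + norm (G xs) * norm (x - xs) + L / 2 * (norm (x - xs))\<^sup>2"
    using between_quadratics_upper[OF bq, of x xs] norm_cauchy_schwarz[of "G xs" "x - xs"]
    by linarith
  \<comment> \<open>Weak duality at \<open>xstar\<close>: Fenchel's inequality for the pair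
    \<open>xstar\<close>, \<open>lam\<close> and the tangent of the regularized function at
    \<open>xs\<close>. The \<epsilon>/2 is the regularizer at distance D.\<close>
  moreover have "?\<phi> xs + lam \<bullet> z - t \<le> f xstar + r + \<epsilon> / 2"
  proof -
    have "ereal ((A *v xstar - b) \<bullet> lam) - h (A *v xstar - b) \<le> conjugate h lam"
      unfolding conjugate_def by (rule SUP_upper) simp
    then have 1: "(A *v xstar - b) \<bullet> lam - r \<le> t" by (simp add: t fin)
    have "(norm (xstar - x0))\<^sup>2 \<le> D\<^sup>2"
      using D by (intro power_mono) (auto simp: norm_minus_commute)
    then have "\<epsilon> / (2 * D\<^sup>2) * (norm (xstar - x0))\<^sup>2 \<le> \<epsilon> / (2 * D\<^sup>2) * D\<^sup>2"
      using \<open>0 \<le> \<epsilon>\<close> by (intro mult_left_mono) auto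
    then have 2: "?\<phi> xstar \<le> f xstar + \<epsilon> / 2" using D by (simp add: regularized_def)
    have "G xs = - (transpose A *v lam)" using stat by (simp add: eq_neg_iff_add_eq_0)
    then have "G xs \<bullet> (xstar - xs) = - (lam \<bullet> (A *v xstar - A *v xs))"
      by (simp only: inner_minus_left transpose_inner matrix_vector_mult_diff_distrib)
    with between_quadratics_lower[OF bq, of xs xstar]
    have "?\<phi> xs - lam \<bullet> (A *v xstar - A *v xs) \<le> ?\<phi> xstar" by simp
    with 1 2 show ?thesis by (simp add: z_def inner_diff_left inner_diff_right inner_commute)
  qed
  ultimately have real_le: "f x + (\<rho> * spectral_norm A * norm (x - xs) + lam \<bullet> z - t) - (f xstar + r)
      \<le> (norm (G xs) + \<rho> * spectral_norm A) * norm (x - xs) + L / 2 * (norm (x - xs))\<^sup>2 + \<epsilon> / 2"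
    using fx by (simp add: distrib_right)
  have "(INF y. objective f h A b y) = objective f h A b xstar"
    by (rule antisym) (auto intro: INF_lower INF_greatest min)
  then have "(INF y. objective f h A b y) = ereal (f xstar + r)"
    by (simp add: objective_def fin)
  \<comment> \<open>\<open>h_trunc\<close> may be minus infinity, in which case the bound is
    trivial.\<close>
  then have "subopt \<rho> f h A b x
      \<le> ereal (f x + (\<rho> * spectral_norm A * norm (x - xs) + lam \<bullet> z - t) - (f xstar + r))"
    using trunc unfolding subopt_def by (cases "h_trunc \<rho> h (A *v x - b)") auto
  also have "\<dots> \<le> ereal ((norm (G xs) + \<rho> * spectral_norm A) * norm (x - xs)
      + L / 2 * (norm (x - xs))\<^sup>2 + \<epsilon> / 2)"
    using real_le by simp
  finally show ?thesis .
qed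

text \<open>The quantities under the logarithms are at most powers of \<open>M\<close>, so the
  logarithms are multiples of ln M; \<open>M\<close> is at least 3, so ln M is at least 1 and
  absorbs additive constants. One logarithm counts outer iterations, the other inner ones. The
  maximum with 1 reflects that L / \<mu> stays at least 1 however small \<open>Lf\<close>
  is.\<close>

lemma gradient_count_le:
  fixes Lf sn msv D \<epsilon> \<rho> nl ng :: real and T :: nat
  defines "M \<equiv> 3 + Lf + sn + 1 / msv + D + 1 / \<epsilon> + \<rho> + nl + ng"
    and "\<kappa> \<equiv> sn / msv" and "\<mu> \<equiv> \<epsilon> / D\<^sup>2"
  defines "L \<equiv> Lf + \<mu>"
  defines "K \<equiv> L + sn\<^sup>2 / (msv\<^sup>2 / L)" and "B \<equiv> 3 * (\<kappa>\<^sup>2 * (L / \<mu>))"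
    and "W \<equiv> (ng + \<rho> * sn) * D / \<epsilon> + L / \<mu>" and "V \<equiv> 2 + D * (msv * nl + ng) / \<epsilon>"
  assumes nonneg: "0 \<le> Lf" "0 < msv" "msv \<le> sn" "0 < D" "0 < \<epsilon>" "0 < \<rho>" "0 \<le> nl" "0 \<le> ng"
    and T: "real T \<le> 24 * ln (4 * W * B * V) + 1"
  shows "real T * (2 * (sqrt (K / \<mu>) * ln (2 * (K / \<mu> * (3 * B))\<^sup>2) + 1))
    \<le> 10 ^ 8 * (\<kappa> * max 1 (sqrt Lf * D / sqrt \<epsilon>)) * (ln M)\<^sup>2"
proof -
  define \<eta> where "\<eta> = L / \<mu>"
  have \<mu>: "0 < \<mu>" using nonneg by (simp add: \<mu>_def)
  then have L: "0 < L" using nonneg by (simp add: L_def)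
  have inv: "0 < 1 / msv" "0 < 1 / \<epsilon>" using nonneg by simp_all
  have M: "3 \<le> M" "Lf \<le> M" "sn \<le> M" "msv \<le> M" "1 / msv \<le> M" "D \<le> M" "1 / \<epsilon> \<le> M" "\<rho> \<le> M" "nl \<le> M" "ng \<le> M"
    unfolding M_def using nonneg inv by linarith+
  have up: "3 * M ^ k \<le> M ^ Suc k" for k
    using M(1) by (simp add: mult_right_mono)
  have M_le: "3 * M \<le> M * M" "3 * (M * M) \<le> M ^ 3"
    using M(1) by (simp_all add: power3_eq_cube mult_right_mono)
  have pow: "1 \<le> M ^ k" for k using M(1) by (simp add: one_le_power)
  have \<kappa>: "1 \<le> \<kappa>" "\<kappa> \<le> M\<^sup>2"
  proof -
    show "1 \<le> \<kappa>" using nonneg by (simp add: \<kappa>_def)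
    have "sn * (1 / msv) \<le> M * M" using M inv by (intro mult_mono) auto
    then show "\<kappa> \<le> M\<^sup>2" by (simp add: \<kappa>_def power2_eq_square)
  qed
  have \<eta>_eq: "\<eta> = 1 + Lf * D\<^sup>2 / \<epsilon>"
    using nonneg by (simp add: \<eta>_def L_def \<mu>_def field_simps)
  have \<eta>: "1 \<le> \<eta>" "\<eta> \<le> M ^ 5"
  proof -
    show "1 \<le> \<eta>" using nonneg by (simp add: \<eta>_eq)
    have "Lf * D\<^sup>2 * (1 / \<epsilon>) \<le> M * M\<^sup>2 * M"
      using M nonneg inv by (intro mult_mono power_mono) auto
    then have "\<eta> \<le> 1 + M ^ 4" by (simp add: \<eta>_eq power_numeral_reduce)
    also have "\<dots> \<le> M ^ 5" using up[of 4] pow[of 4] by simp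
    finally show "\<eta> \<le> M ^ 5" .
  qed
  have B_eq: "B = 3 * (\<kappa>\<^sup>2 * \<eta>)" by (simp add: B_def \<eta>_def)
  have B: "3 \<le> B" "B \<le> M ^ 10"
  proof -
    have "1 * 1 \<le> \<kappa>\<^sup>2 * \<eta>" using \<kappa> \<eta> by (intro mult_mono) auto
    then show "3 \<le> B" by (simp add: B_eq)
    have "3 * (\<kappa>\<^sup>2 * \<eta>) \<le> M * ((M\<^sup>2)\<^sup>2 * M ^ 5)"
      using M \<kappa> \<eta> by (intro mult_mono power_mono) auto
    then show "B \<le> M ^ 10" by (simp add: B_eq flip: power_mult power_add power_Suc)
  qed
  have W: "1 \<le> W" "W \<le> M ^ 6"
  proof -
    have "0 \<le> (ng + \<rho> * sn) * D / \<epsilon>" using nonneg by simp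
    then show "1 \<le> W" using \<eta>(1) by (simp add: W_def \<eta>_def)
    have "\<rho> * sn \<le> M * M" using M nonneg by (intro mult_mono) auto
    then have "ng + \<rho> * sn \<le> M ^ 3"
      using M(1,10) M_le by linarith
    then have "(ng + \<rho> * sn) * D * (1 / \<epsilon>) \<le> M ^ 3 * M * M"
      using M nonneg inv by (intro mult_mono) auto
    also have "\<dots> = M ^ 5" by (simp add: power_numeral_reduce)
    finally have "W \<le> M ^ 5 + M ^ 5" using \<eta>(2) by (simp add: W_def \<eta>_def)
    also have "\<dots> \<le> M ^ 6" using up[of 5] pow[of 5] by simp
    finally show "W \<le> M ^ 6" .
  qed
  have V: "2 \<le> V" "V \<le> M ^ 6"
  proof -
    show "2 \<le> V" using nonneg by (simp add: V_def)
    have "msv * nl \<le> M * M" using M nonneg by (intro mult_mono) auto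
    then have "msv * nl + ng \<le> M ^ 3"
      using M(1,10) M_le by linarith
    then have "D * (msv * nl + ng) * (1 / \<epsilon>) \<le> M * M ^ 3 * M"
      using M nonneg inv by (intro mult_mono) auto
    also have "\<dots> = M ^ 5" by (simp add: power_numeral_reduce)
    finally have "V \<le> 2 + M ^ 5" by (simp add: V_def)
    also have "\<dots> \<le> M ^ 6" using up[of 5] pow[of 5] by simp
    finally show "V \<le> M ^ 6" .
  qed
  have ln3: "1 \<le> ln M"
  proof -
    have "exp 1 \<le> M" using exp_le M(1) by linarith
    then show ?thesis using ln_mono[of "exp 1" M] by simp
  qed
  define m where "m = max 1 (sqrt Lf * D / sqrt \<epsilon>)"
  have m: "1 \<le> m" by (simp add: m_def)
  have "4 \<le> M\<^sup>2" using M(1) M_le(1) unfolding power2_eq_square by linarith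
  then have "4 * W * B * V \<le> M\<^sup>2 * M ^ 6 * M ^ 10 * M ^ 6"
    using M W B V by (intro mult_mono) auto
  also have "\<dots> = M ^ 24" by (simp flip: power_add)
  finally have "ln (4 * W * B * V) \<le> ln (M ^ 24)"
    using W B V by (intro ln_mono) auto
  also have "\<dots> = 24 * ln M" using M by (simp add: ln_realpow)
  \<comment> \<open>577 = 24 * 24 + 1.\<close>
  finally have T': "real T \<le> 577 * ln M" using T ln3 by linarith
  have K_eq: "K / \<mu> = \<eta> * (1 + \<kappa>\<^sup>2)"
    using L nonneg by (simp add: K_def \<eta>_def \<kappa>_def power_divide field_simps)
  have K: "K / \<mu> \<le> 2 * \<kappa>\<^sup>2 * \<eta>"
  proof -
    have "1 \<le> \<kappa>\<^sup>2" using \<kappa> by simp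
    then have "\<eta> * (1 + \<kappa>\<^sup>2) \<le> \<eta> * (2 * \<kappa>\<^sup>2)" using \<eta> by (intro mult_left_mono) auto
    then show ?thesis by (simp add: K_eq mult_ac)
  qed
  have K_pos: "0 < K / \<mu>" using \<eta> by (simp add: K_eq add_pos_nonneg)
  have "\<eta> \<le> 2 * m\<^sup>2"
  proof -
    have "1 \<le> m\<^sup>2" using m by simp
    moreover have "(sqrt Lf * D / sqrt \<epsilon>)\<^sup>2 \<le> m\<^sup>2"
      using nonneg by (intro power_mono) (auto simp: m_def)
    ultimately show ?thesis
      using nonneg by (simp add: \<eta>_eq power_divide power_mult_distrib)
  qed
  then have "2 * \<kappa>\<^sup>2 * \<eta> \<le> 2 * \<kappa>\<^sup>2 * (2 * m\<^sup>2)" by (intro mult_left_mono) auto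
  also have "\<dots> = (2 * \<kappa> * m)\<^sup>2" by (simp add: power_mult_distrib)
  finally have "K / \<mu> \<le> (2 * \<kappa> * m)\<^sup>2" using K by simp
  then have sqrtK: "sqrt (K / \<mu>) \<le> 2 * \<kappa> * m" using \<kappa> m by (intro real_le_lsqrt) auto
  have "K / \<mu> * (3 * B) \<le> (2 * (M\<^sup>2)\<^sup>2 * M ^ 5) * (M * M ^ 10)"
  proof -
    have "2 * \<kappa>\<^sup>2 * \<eta> \<le> 2 * (M\<^sup>2)\<^sup>2 * M ^ 5"
      using \<kappa> \<eta> by (intro mult_mono power_mono) auto
    with K have "K / \<mu> \<le> 2 * (M\<^sup>2)\<^sup>2 * M ^ 5" by (rule order_trans)
    then show ?thesis using M B K_pos by (intro mult_mono) auto
  qed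
  also have "\<dots> = 2 * M ^ 20" by (simp flip: power_mult power_add power_Suc)
  finally have "(K / \<mu> * (3 * B))\<^sup>2 \<le> (2 * M ^ 20)\<^sup>2"
    using K_pos B by (intro power_mono mult_nonneg_nonneg) auto
  then have "2 * (K / \<mu> * (3 * B))\<^sup>2 \<le> 8 * M ^ 40"
    by (simp add: power_mult_distrib flip: power_mult)
  also have "\<dots> \<le> M ^ 42" using up[of 40] up[of 41] pow[of 40] by simp
  finally have "ln (2 * (K / \<mu> * (3 * B))\<^sup>2) \<le> ln (M ^ 42)"
    using K_pos B by (intro ln_mono) auto
  also have "\<dots> = 42 * ln M" using M by (simp add: ln_realpow)
  finally have "sqrt (K / \<mu>) * ln (2 * (K / \<mu> * (3 * B))\<^sup>2) \<le> 2 * \<kappa> * m * (42 * ln M)"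
    using sqrtK K_pos \<kappa> m ln3 by (intro order_trans[OF mult_left_mono mult_right_mono]) auto
  moreover have "1 * 1 * 1 \<le> \<kappa> * m * ln M"
    using \<kappa> m ln3 by (intro mult_mono) auto
  ultimately have "2 * (sqrt (K / \<mu>) * ln (2 * (K / \<mu> * (3 * B))\<^sup>2) + 1) \<le> 170 * (\<kappa> * m * ln M)"
    by simp
  then have "real T * (2 * (sqrt (K / \<mu>) * ln (2 * (K / \<mu> * (3 * B))\<^sup>2) + 1))
      \<le> real T * (170 * (\<kappa> * m * ln M))"
    by (intro mult_left_mono) auto
  also have "\<dots> \<le> 577 * ln M * (170 * (\<kappa> * m * ln M))"
    using T' \<kappa> m ln3 by (intro mult_right_mono) auto
  also have "\<dots> = 98090 * (\<kappa> * m * (ln M)\<^sup>2)" by (simp add: power2_eq_square)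
  also have "\<dots> \<le> 10 ^ 8 * (\<kappa> * m * (ln M)\<^sup>2)"
    using \<kappa> m by (intro mult_right_mono) auto
  finally show ?thesis by (simp add: m_def mult.assoc)
qed

theorem corollary3:
  fixes f :: "real^'n \<Rightarrow> real" and h :: "real^'m \<Rightarrow> ereal"
    and A :: "real^'n^'m" and b :: "real^'m"
    and x0 xstar :: "real^'n" and lam0 :: "real^'m"
    and Lf D \<rho> \<epsilon> :: real
  assumes "convex_on UNIV f" and "smooth Lf f"
    and "proper_closed_convex h"
    and "rank A = CARD('m)"
    and "\<forall>x. objective f h A b xstar \<le> objective f h A b x"
    and "0 < D" and "norm (x0 - xstar) \<le> D"
    and "0 < \<rho>" and "0 < \<epsilon>"
  shows "\<exists>l R T xhat lamhat N.
     mu_Phi A (Lf + \<epsilon> / D\<^sup>2) \<le> l \<and> 0 < R \<and> 1 \<le> T \<and>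
     inexact_ppa (regularized f \<epsilon> D x0) h A b (Lf + \<epsilon> / D\<^sup>2) (\<epsilon> / D\<^sup>2) l R x0 lam0
       T xhat lamhat N \<and>
     subopt \<rho> f h A b xhat \<le> ereal \<epsilon> \<and>
     real N \<le> 10 ^ 8 * (condition_number A * max 1 (sqrt Lf * D / sqrt \<epsilon>))
       * (ln (3 + Lf + spectral_norm A + 1 / min_singular_value A + D + 1 / \<epsilon> + \<rho>
              + norm lam0 + norm (grad f x0)))\<^sup>2"
proof -
  define \<mu> where "\<mu> = \<epsilon> / D\<^sup>2"
  define L where "L = Lf + \<mu>"
  define G where "G x = grad f x + \<mu> *\<^sub>R (x - x0)" for x
  define sn where "sn = spectral_norm A"
  define msv where "msv = min_singular_value A"
  define g0 where "g0 = norm (grad f x0)"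
  have Lf: "0 \<le> Lf" using assms(2) by (auto simp: smooth_def dest: lipschitz_on_nonneg)
  have \<mu>: "0 < \<mu>" "\<mu> \<le> L" using assms Lf by (auto simp: \<mu>_def L_def)
  have bqf: "between_quadratics 0 Lf f (grad f)"
    using assms by (intro convex_smooth_between_quadratics)
  then have bq: "between_quadratics \<mu> L (regularized f \<epsilon> D x0) G"
    unfolding \<mu>_def L_def G_def[abs_def] by (rule regularized_between_quadratics)
  have "GDERIV f xstar :> grad f xstar"
    using between_quadratics_gderiv[OF bqf] by simp
  then obtain \<nu> where \<nu>: "grad f xstar + transpose A *v \<nu> = 0"
    and h_sub: "has_subgradient h (A *v xstar - b) \<nu>"
    using lagrange_multiplier_exists[OF assms(4,3)] assms(5) by blast
  note g_sub = conjugate_has_subgradient[OF h_sub]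
  obtain r where r: "h (A *v xstar - b) = ereal r"
    using h_sub by (auto simp: has_subgradient_def)
  obtain s where s: "conjugate h \<nu> = ereal s"
    and minor: "\<And>u. ereal (s + (A *v xstar - b) \<bullet> (u - \<nu>)) \<le> conjugate h u"
    using g_sub by (auto simp: has_subgradient_def)
  \<comment> \<open>The minorant is the affine function supporting the conjugate at \<nu>, with
    slope \<open>A *v xstar - b\<close>.\<close>
  interpret composite_problem "regularized f \<epsilon> D x0" G h A b \<mu> L
    "A *v xstar - b" "s - (A *v xstar - b) \<bullet> \<nu>"
  proof
    show "proper_closed_convex (conjugate h)"
      using assms(3) r s
      by (intro proper_closed_convex_conjugate[of h "A *v xstar - b" \<nu>])
        (auto simp: proper_closed_convex_def)
    show "ereal ((A *v xstar - b) \<bullet> u + (s - (A *v xstar - b) \<bullet> \<nu>)) \<le> conjugate h u" for u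
      using minor[of u] by (simp add: inner_diff_right algebra_simps)
  qed (use bq \<mu> assms in auto)
  obtain xs ls where saddle: "ppa_saddle ls xs ls" using saddle_point_exists by blast
  then have stat: "G xs + transpose A *v ls = 0"
    and xs_sub: "has_subgradient (conjugate h) ls (A *v xs - b)"
    by (auto simp: ppa_saddle_def)
  have "norm (xs - x0) \<le> norm (x0 - xstar)"
    using regularized_solution_near[OF bqf \<mu>(1) \<nu> g_sub _ xs_sub] stat by (simp add: G_def)
  with assms(7) have near: "norm (xs - x0) \<le> D" by simp
  have Gxs: "norm (G xs) \<le> g0 + L * D"
  proof -
    have "norm (G xs - G x0) \<le> L * norm (xs - x0)"
      using between_quadratics_lipschitz[OF bq] \<mu> by simp
    also have "\<dots> \<le> L * D" using near \<mu> by (intro mult_left_mono) auto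
    finally show ?thesis
      using norm_triangle_sub[of "G xs" "G x0"] by (simp add: g0_def G_def)
  qed
  have msv: "0 < msv" "msv \<le> sn"
    using min_singular_value(1)[OF rank] min_singular_value_le_spectral_norm[OF rank]
    by (auto simp: msv_def sn_def)
  define \<kappa> where "\<kappa> = sn / msv"
  define B where "B = 3 * (\<kappa>\<^sup>2 * (L / \<mu>))"
  \<comment> \<open>\<open>W\<close> makes (g0 + \<rho> sn) D + L D^2 equal to \<epsilon> W, so a
    distance of D / (4 W) to \<open>xs\<close> costs \<epsilon>/4 in the linear term and at most
    that in the quadratic one.\<close>
  define W where "W = (g0 + \<rho> * sn) * D / \<epsilon> + L / \<mu>"
  define V where "V = 2 + D * (msv * norm lam0 + g0) / \<epsilon>"
  \<comment> \<open>The two summands serve the two initial conditions of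
    \<open>inexact_ppa_run\<close>; \<open>V\<close> bounds R / D by problem data.\<close>
  define R where "R = D + norm (lam0 - ls) / (sn / l)"
  \<comment> \<open>After \<open>T\<close> steps the tolerance factor exp (- T / 24) is at most 1 /
    (4 W B V); \<open>B\<close> cancels the primal constant and \<open>V\<close> cancels R /
    D.\<close>
  define T where "T = nat \<lceil>24 * ln (4 * W * B * V)\<rceil>"
  have g0: "0 \<le> g0" by (simp add: g0_def)
  have \<eta>: "1 \<le> L / \<mu>" using \<mu> by simp
  have "1 \<le> \<kappa>" using msv by (simp add: \<kappa>_def)
  then have "1 * 1 \<le> \<kappa>\<^sup>2 * (L / \<mu>)" using \<eta> by (intro mult_mono) auto
  then have B: "3 \<le> B" by (simp add: B_def)
  have "0 \<le> (g0 + \<rho> * sn) * D / \<epsilon>" using assms g0 msv by simp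
  then have W: "L / \<mu> \<le> W" "1 \<le> W" using \<eta> by (auto simp: W_def)
  have V: "2 \<le> V" using assms g0 msv by (simp add: V_def)
  have R: "D \<le> R" "0 < R" using assms msv l_pos by (auto simp: R_def add_pos_nonneg)
  have RV: "R \<le> V * D"
  proof -
    \<comment> \<open>Stationarity and the least singular value bound the dual solution by the
      gradient at \<open>xs\<close>.\<close>
    have "msv * norm ls \<le> norm (G xs)"
      using min_singular_value(2)[OF rank, of ls] stat
      by (simp add: msv_def eq_neg_iff_add_eq_0[symmetric])
    then have "msv * norm (lam0 - ls) \<le> msv * norm lam0 + g0 + L * D"
      using Gxs mult_left_mono[OF norm_triangle_ineq4[of lam0 ls], of msv] msv
      by (simp add: distrib_left)
    moreover have "norm (lam0 - ls) / (sn / l) \<le> msv * norm (lam0 - ls) / L"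
    proof -
      have "norm (lam0 - ls) / (sn / l) = (msv / sn) * (msv * norm (lam0 - ls) / L)"
        by (simp add: l_eq msv_def power2_eq_square)
      also have "\<dots> \<le> 1 * (msv * norm (lam0 - ls) / L)"
        using msv \<mu> by (intro mult_right_mono) auto
      finally show ?thesis by simp
    qed
    ultimately have "norm (lam0 - ls) / (sn / l) \<le> (msv * norm lam0 + g0 + L * D) / L"
      using \<mu> by (smt (verit) divide_right_mono)
    also have "\<dots> = (msv * norm lam0 + g0) / L + D"
      using \<mu> by (simp add: add_divide_distrib)
    also have "\<dots> \<le> (msv * norm lam0 + g0) / \<mu> + D"
      using \<mu> msv g0 by (intro add_right_mono divide_left_mono) auto
    also have "(msv * norm lam0 + g0) / \<mu> = D * (msv * norm lam0 + g0) / \<epsilon> * D"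
      by (simp add: \<mu>_def power2_eq_square)
    finally show ?thesis by (simp add: R_def V_def distrib_right)
  qed
  have "4 * 1 * 3 * 2 \<le> 4 * W * B * V"
    using W B V by (intro mult_mono) auto
  then have lnpos: "1 < 4 * W * B * V" by linarith
  then have "0 < 24 * ln (4 * W * B * V)" using ln_gt_zero by (metis mult_pos_pos zero_less_numeral)
  then have T: "1 \<le> T" "24 * ln (4 * W * B * V) \<le> real T" "real T \<le> 24 * ln (4 * W * B * V) + 1"
    unfolding T_def by linarith+
  have "norm (x0 - xs) \<le> B * R"
  proof -
    have "1 * R \<le> B * R" using B R by (intro mult_right_mono) auto
    then show ?thesis using near R(1) norm_minus_commute[of x0 xs] by linarith
  qed
  moreover have "norm (lam0 - ls) \<le> 3 * (sn / l) * R"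
  proof -
    have "0 < sn / l" using msv l_pos by simp
    then have "norm (lam0 - ls) = (sn / l) * (norm (lam0 - ls) / (sn / l))"
      using msv l_pos by simp
    also have "\<dots> \<le> (sn / l) * R"
      using \<open>0 < sn / l\<close> assms(6) by (intro mult_left_mono) (auto simp: R_def)
    also have "\<dots> \<le> 3 * (sn / l) * R"
      using \<open>0 < sn / l\<close> R(2) by (intro mult_right_mono) auto
    finally show ?thesis .
  qed
  ultimately obtain x lam N where run:
    "inexact_ppa (regularized f \<epsilon> D x0) h A b L \<mu> l R x0 lam0 T x lam N"
    and x: "norm (x - xs) \<le> B * ppa_tolerance A L l R T"
    and N: "real N \<le> real T * (2 * (sqrt ((L + sn\<^sup>2 / l) / \<mu>)
      * ln (2 * ((L + sn\<^sup>2 / l) / \<mu> * (3 * B))\<^sup>2) + 1))"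
    using inexact_ppa_run[OF saddle R(2), of x0 lam0 T]
    unfolding B_def \<kappa>_def sn_def msv_def condition_number_def[symmetric] by blast
  have e: "norm (x - xs) \<le> D / (4 * W)"
  proof -
    define Z where "Z = 4 * W * B * V"
    have Z: "1 < Z" "24 * ln Z \<le> real T" using lnpos T(2) by (simp_all only: Z_def)
    then have "exp (- (real T / 24)) \<le> exp (- ln Z)" by simp
    also have "\<dots> = 1 / Z" using Z(1) by (simp add: exp_minus divide_inverse)
    finally have "exp (- (real T / 24)) * R \<le> 1 / (4 * W * B * V) * (V * D)"
      unfolding Z_def[symmetric] using RV R Z(1) by (intro mult_mono) auto
    with ppa_tolerance_le_exp[OF R(2), of T]
    have "B * ppa_tolerance A L l R T \<le> B * (1 / (4 * W * B * V) * (V * D))"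
      using B by (intro mult_left_mono) auto
    also have "\<dots> = D / (4 * W)" using B V by simp
    finally show ?thesis using x by simp
  qed
  have LD: "L * D\<^sup>2 = \<epsilon> * (L / \<mu>)" using assms by (simp add: \<mu>_def)
  have first: "(norm (G xs) + \<rho> * sn) * norm (x - xs) \<le> \<epsilon> / 4"
  proof -
    have "(norm (G xs) + \<rho> * sn) * norm (x - xs) \<le> (g0 + L * D + \<rho> * sn) * (D / (4 * W))"
      using Gxs e assms msv g0 \<mu> W by (intro mult_mono) auto
    also have "\<dots> = ((g0 + \<rho> * sn) * D + L * D\<^sup>2) / (4 * W)"
      by (simp add: algebra_simps power2_eq_square add_divide_distrib)
    also have "(g0 + \<rho> * sn) * D + L * D\<^sup>2 = \<epsilon> * W"
      unfolding LD W_def using assms by (simp add: distrib_left)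
    finally show ?thesis using W by simp
  qed
  have second: "L / 2 * (norm (x - xs))\<^sup>2 \<le> \<epsilon> / 4"
  proof -
    have "L / 2 * (norm (x - xs))\<^sup>2 \<le> L / 2 * (D / (4 * W))\<^sup>2"
      using e \<mu> by (intro mult_left_mono power_mono) auto
    also have "\<dots> = \<epsilon> * (L / \<mu>) / (32 * W\<^sup>2)"
      unfolding LD[symmetric] by (simp add: power_divide power_mult_distrib)
    also have "\<dots> \<le> \<epsilon> * W / (32 * W\<^sup>2)"
      using W assms by (intro divide_right_mono mult_left_mono) auto
    also have "\<dots> = \<epsilon> / (32 * W)" using W by (simp add: power2_eq_square)
    also have "\<dots> \<le> \<epsilon> / 4" using W assms by (intro divide_left_mono) auto
    finally show ?thesis .
  qed
  have "subopt \<rho> f h A b x \<le> ereal ((norm (G xs) + \<rho> * sn) * norm (x - xs)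
      + L / 2 * (norm (x - xs))\<^sup>2 + \<epsilon> / 2)"
    unfolding sn_def
    using assms(5-9) r xs_sub stat between_quadratics_mono[OF bq, of 0 L] \<mu>
    by (intro subopt_le[where G = G and xs = xs and lam = ls and xstar = xstar and r = r]) auto
  also have "\<dots> \<le> ereal \<epsilon>" using first second by simp
  finally have "subopt \<rho> f h A b x \<le> ereal \<epsilon>" .
  moreover have "real N \<le> 10 ^ 8 * (\<kappa> * max 1 (sqrt Lf * D / sqrt \<epsilon>))
      * (ln (3 + Lf + sn + 1 / msv + D + 1 / \<epsilon> + \<rho> + norm lam0 + g0))\<^sup>2"
    using gradient_count_le[OF Lf msv assms(6,9,8) norm_ge_zero[of lam0] g0, of T,
        folded \<mu>_def, folded L_def \<kappa>_def, folded B_def W_def V_def l_eq[folded msv_def]]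
      N T(3)
    by linarith
  moreover have "mu_Phi A L \<le> l" by (simp add: l_def)
  ultimately show ?thesis
    using run R(2) T(1)
    unfolding L_def \<mu>_def \<kappa>_def sn_def msv_def g0_def condition_number_def by blast
qed

end
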